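(* Let $\nu\ge1$ and let $\Xi=R^{1/\nu}\,\Xi^0\subset\mathbb{R}^\nu$ be a random homothetic grain, with $R>0$ a random variable and $\Xi^0$ a random closed set independent of $R$, such that $\Xi^0\subset\{\boldsymbol{t}\in\mathbb{R}^\nu:|\boldsymbol{t}|\le1\}$ a.s. and $\mathrm{Leb}_\nu(\Xi^0)>0$ a.s. (i) Assume that there exist $\alpha\in(1,2)$ and $c_R>0$ such that $\mathrm{P}(R>x)\sim c_R\,x^{-\alpha}$ as $x\to\infty$. Then $$\mathrm{P}(\mathrm{Leb}_\nu(\Xi)>x)\sim c_\Xi\,x^{-\alpha}\quad(x\to\infty),\qquad c_\Xi=c_R\,\mathrm{E}\big[\mathrm{Leb}_\nu(\Xi^0)^\alpha\big],$$ and $$\mathrm{E}\,\mathrm{Leb}_\nu\big(\Xi\cap\{|\boldsymbol{t}|>\lambda\}\big)=o\big(\lambda^{(1-\alpha)\nu/\alpha}\big)\quad(\lambda\to\infty).$$ Moreover, the covariance $r_X(\boldsymbol{t})=\mathrm{Cov}(X(\boldsymbol{0}),X(\boldsymbol{t}))=\mathrm{E}\,\mathrm{Leb}_\nu(\Xi\cap(\Xi-\boldsymbol{t}))$ of the random grain model $X$ with generic grain $\Xi$ satisfies $$r_X(\boldsymbol{t})=O\big(|\boldsymbol{t}|^{-\nu(\alpha-1)}\big),\qquad|\boldsymbol{t}|\to\infty.$$ (ii) Assume that $R$ has a density $f$ and that there exist $\alpha\in(1,2)$ and $c_f>0$ such that $f(r)\sim c_f\,r^{-1-\alpha}$ as $r\to\infty$,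 and assume also that the function $\boldsymbol{t}\mapsto\mathrm{E}\,\mathrm{Leb}_\nu(\Xi^0\cap(\Xi^0-\boldsymbol{t}))$ is continuous on $\mathbb{R}^\nu\setminus\{\boldsymbol{0}\}$. Then $$r_X(\boldsymbol{t})=|\boldsymbol{t}|^{-\nu(\alpha-1)}\Big(\ell\Big(\frac{\boldsymbol{t}}{|\boldsymbol{t}|}\Big)+o(1)\Big),\qquad|\boldsymbol{t}|\to\infty,$$ where $\ell$ is the function on the unit sphere $S_{\nu-1}$ of $\mathbb{R}^\nu$ given by $$\ell(\boldsymbol{z}):=c_f\int_0^\infty\mathrm{E}\,\mathrm{Leb}_\nu\big(\Xi^0\cap(\Xi^0-r^{-1/\nu}\boldsymbol{z})\big)\,r^{-\alpha}\,\mathrm{d}r,\qquad \boldsymbol{z}\in S_{\nu-1}.$$ (iii) Assume that $\mathrm{E}R^2<\infty$. Then $\mathrm{E}\,\mathrm{Leb}_\nu(\Xi)^2<\infty$.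
   Context: $\mathrm{Leb}_\nu$ is Lebesgue measure on $\mathbb{R}^\nu$, $|\cdot|$ the Euclidean norm, $\mathbb{I}$ an indicator. A random closed set is a measurable map from a complete probability space into the space of closed subsets of $\mathbb{R}^\nu$ with the Borel $\sigma$-algebra of the Fell topology. Random grain model with generic grain $\Xi$ (a random closed set with $\mathrm{E}\,\mathrm{Leb}_\nu(\Xi)<\infty$): let $\{\boldsymbol{u}_j;j\ge1\}$ be a stationary Poisson point process on $\mathbb{R}^\nu$ with unit intensity and let $\{\Xi,\Xi_j;j\ge1\}$ be i.i.d., independent of $\{\boldsymbol{u}_j\}$; then $$X(\boldsymbol{t})=\sum_{j=1}^\infty\mathbb{I}\big(\boldsymbol{t}\in(\boldsymbol{u}_j+\Xi_j)\big),\qquad\boldsymbol{t}\in\mathbb{R}^\nu,$$ whose covariance is $\mathrm{Cov}(X(\boldsymbol{0}),X(\boldsymbol{t}))=\mathrm{E}\,\mathrm{Leb}_\nu(\Xi\cap(\Xi-\boldsymbol{t}))$. *)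

theory Defs
  imports "HOL-Probability.Probability" "HOL-Library.Landau_Symbols"
begin

text \<open>The Fell (hit-or-miss) topology on the closed subsets of a topological space. Taking
  \<open>K = {}\<close> shows that its underlying set is the set of all closed sets, including the empty one.\<close>

definition fell_topology :: "'a::topological_space set topology" where
  "fell_topology = topology_generated_by
     ({{F. closed F \<and> F \<inter> K = {}} |K. compact K} \<union> {{F. closed F \<and> F \<inter> G \<noteq> {}} |G. open G})"

definition fell_borel :: "'a::topological_space set measure" where
  "fell_borel = sigma {F. closed F} {U. openin fell_topology U}"

definition random_closed_set :: "'w measure \<Rightarrow> ('w \<Rightarrow> 'a::topological_space set) \<Rightarrow> bool" where
  "random_closed_set M \<Xi> \<longleftrightarrow> prob_space M \<and> complete_measure M \<and> \<Xi> \<in> measurable M fell_borel"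

text \<open>The library's \<open>indep_var\<close> needs both random variables to have the same value type. Here
  they may differ; the condition on the generated \<open>\<sigma>\<close>-algebras is the same.\<close>

definition indep_rvs :: "'w measure \<Rightarrow> 'a measure \<Rightarrow> ('w \<Rightarrow> 'a) \<Rightarrow> 'b measure \<Rightarrow> ('w \<Rightarrow> 'b) \<Rightarrow> bool" where
  "indep_rvs M A X B Y \<longleftrightarrow> X \<in> measurable M A \<and> Y \<in> measurable M B \<and>
     prob_space.indep_set M {X -` S \<inter> space M |S. S \<in> sets A} {Y -` S \<inter> space M |S. S \<in> sets B}"

text \<open>A sequence \<open>u\<close> of random points enumerates a Poisson process whose intensity measure is
  Lebesgue measure, i.e. a stationary Poisson process with unit intensity: \<open>point_count u A\<close>, the
  possibly infinite number of indices \<open>j\<close> with \<open>u j\<close> in \<open>A\<close>, is Poisson distributed with mean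
  \<open>Leb A\<close>, and the counts in disjoint sets are independent.\<close>

definition point_count :: "(nat \<Rightarrow> 'w \<Rightarrow> 'a) \<Rightarrow> 'a set \<Rightarrow> 'w \<Rightarrow> ennreal" where
  "point_count u A \<omega> = emeasure (count_space UNIV) {j. u j \<omega> \<in> A}"

definition unit_poisson_process :: "'w measure \<Rightarrow> (nat \<Rightarrow> 'w \<Rightarrow> 'a::euclidean_space) \<Rightarrow> bool" where
  "unit_poisson_process N u \<longleftrightarrow>
     prob_space N \<and> (\<forall>j. u j \<in> borel_measurable N) \<and>
     (\<forall>A \<in> sets borel. bounded A \<longrightarrow> (\<forall>k::nat.
        measure N {\<omega> \<in> space N. point_count u A \<omega> = of_nat k} =
          exp (- measure lborel A) * measure lborel A ^ k / fact k)) \<and>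
     (\<forall>(n::nat) A. (\<forall>i<n. A i \<in> sets borel \<and> bounded (A i)) \<and> disjoint_family_on A {..<n} \<longrightarrow>
        prob_space.indep_vars N (\<lambda>_. borel) (\<lambda>i. point_count u (A i)) {..<n})"

text \<open>The generic grain \<open>\<Xi>\<close> enters the model only through its distribution, so the points \<open>u\<close> and
  the grains \<open>G\<close> (i.i.d. copies of \<open>\<Xi>\<close>) may live on another probability space \<open>N\<close> than \<open>\<Xi>\<close>.\<close>

definition random_grain_model ::
  "'w measure \<Rightarrow> ('w \<Rightarrow> 'a::euclidean_space set) \<Rightarrow>
   'v measure \<Rightarrow> (nat \<Rightarrow> 'v \<Rightarrow> 'a) \<Rightarrow> (nat \<Rightarrow> 'v \<Rightarrow> 'a set) \<Rightarrow> bool" where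
  "random_grain_model M \<Xi> N u G \<longleftrightarrow>
     random_closed_set M \<Xi> \<and> (\<integral>\<^sup>+\<omega>. emeasure lborel (\<Xi> \<omega>) \<partial>M) < \<infinity> \<and>
     unit_poisson_process N u \<and>
     (\<forall>j. random_closed_set N (G j) \<and> distr N fell_borel (G j) = distr M fell_borel \<Xi>) \<and>
     prob_space.indep_vars N (\<lambda>_. fell_borel) G UNIV \<and>
     indep_rvs N (Pi\<^sub>M UNIV (\<lambda>_. borel)) (\<lambda>\<omega> j. u j \<omega>) (Pi\<^sub>M UNIV (\<lambda>_. fell_borel)) (\<lambda>\<omega> j. G j \<omega>)"

text \<open>The field \<open>X\<close>. Where the number of grains covering \<open>t\<close> is infinite (a null event in the random
  grain model) its value is irrelevant.\<close>

definition grain_field ::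
  "(nat \<Rightarrow> 'v \<Rightarrow> 'a::real_vector) \<Rightarrow> (nat \<Rightarrow> 'v \<Rightarrow> 'a set) \<Rightarrow> 'a \<Rightarrow> 'v \<Rightarrow> real" where
  "grain_field u G t \<omega> = (\<Sum>j. indicator ((\<lambda>x. u j \<omega> + x) ` G j \<omega>) t)"

definition covar :: "'w measure \<Rightarrow> ('w \<Rightarrow> real) \<Rightarrow> ('w \<Rightarrow> real) \<Rightarrow> real" where
  "covar M X Y = (\<integral>\<omega>. (X \<omega> - (\<integral>\<omega>'. X \<omega>' \<partial>M)) * (Y \<omega> - (\<integral>\<omega>'. Y \<omega>' \<partial>M)) \<partial>M)"

text \<open>\<open>E Leb(\<Xi> \<inter> (\<Xi> - t))\<close>. Only Borel sets are measured, so \<open>lborel\<close> serves as Lebesgue measure.\<close>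

definition mean_overlap :: "'w measure \<Rightarrow> ('w \<Rightarrow> 'a::euclidean_space set) \<Rightarrow> 'a \<Rightarrow> real" where
  "mean_overlap M \<Xi> t = (\<integral>\<omega>. measure lborel (\<Xi> \<omega> \<inter> (\<lambda>x. x - t) ` \<Xi> \<omega>) \<partial>M)"

definition homothetic_grain ::
  "('w \<Rightarrow> real) \<Rightarrow> ('w \<Rightarrow> 'a::euclidean_space set) \<Rightarrow> 'w \<Rightarrow> 'a set" where
  "homothetic_grain R \<Xi>0 \<omega> = (\<lambda>x. R \<omega> powr (1 / real DIM('a)) *\<^sub>R x) ` \<Xi>0 \<omega>"

definition angular_function ::
  "'w measure \<Rightarrow> ('w \<Rightarrow> 'a::euclidean_space set) \<Rightarrow> real \<Rightarrow> real \<Rightarrow> 'a \<Rightarrow> real" where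
  "angular_function M \<Xi>0 c \<alpha> z =
     c * (LINT r:{0<..}|lborel. mean_overlap M \<Xi>0 (r powr (- 1 / real DIM('a)) *\<^sub>R z) * r powr (- \<alpha>))"

end

theory Submission
  imports Defs
begin

text \<open>
  The covariance formula is a second-moment computation. For a Poisson process with unit intensity,
  the sums of \<open>p (u j)\<close> and of \<open>q (u j)\<close> over \<open>j\<close> have means \<open>\<integral>p\<close>, \<open>\<integral>q\<close> and product moment
  \<open>\<integral>p * \<integral>q + \<integral>(p * q)\<close>. Let \<open>p x\<close> be the probability that \<open>\<Xi>\<close> contains \<open>x\<close>. Given the points, the
  grains are independent, so the expectation of the double sum \<open>X(0) X(t)\<close> differs from that of the
  sum of all \<open>p (- u j) * p (t - u k)\<close> only on the diagonal \<open>j = k\<close>, where the probability that one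
  grain contains both points takes the place of the product. The Poisson product moment contains
  exactly the diagonal that has to be removed. What remains besides the squared mean is the integral
  of \<open>P(x \<in> \<Xi>, x + t \<in> \<Xi>)\<close> over \<open>x\<close>, that is \<open>E Leb(\<Xi> \<inter> (\<Xi> - t))\<close> by Fubini.

  For a homothetic grain everything follows from scaling. Write \<open>d\<close> for the dimension, \<open>V\<close> for the
  volume of the unit ball and \<open>g s = E Leb(\<Xi>0 \<inter> (\<Xi>0 - s))\<close>. Then \<open>g \<le> V\<close> and \<open>g s = 0\<close> for
  \<open>norm s > 2\<close>, and independence gives \<open>E Leb(\<Xi> \<inter> (\<Xi> - t)) = E (R * g (t / R^(1/d)))\<close>
  (lemma \<open>nn_integral_grain_overlap\<close>). Only radii with \<open>R > (norm t / 4)^d\<close> contribute, so the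
  covariance is at most \<open>V\<close> times a truncated mean \<open>E (R; R > y)\<close>, which for a tail of order
  \<open>x^(-\<alpha>)\<close> is \<open>O(y^(1 - \<alpha>))\<close> (\<open>truncated_mean_bound\<close>). In the same way only \<open>R > l^d\<close> contributes
  to the mean volume outside the ball of radius \<open>l\<close>. This volume is therefore of order
  \<open>l^(d (1 - \<alpha>))\<close>, which is smaller than \<open>l^(d (1 - \<alpha>) / \<alpha>)\<close> because \<open>\<alpha> > 1\<close>.

  The tail of the volume is an instance of Breiman's theorem with a bounded factor: \<open>Leb \<Xi> = R * v\<close>
  with \<open>v = Leb \<Xi>0 \<le> V\<close> independent of \<open>R\<close>, and \<open>x^\<alpha> P(R v > x | v) = v^\<alpha> h(x / v)\<close>, where
  \<open>h y = y^\<alpha> P(R > y)\<close> is bounded and tends to \<open>c\<close>, so that dominated convergence applies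
  (\<open>grain_volume_tail\<close>).

  If \<open>R\<close> has a density \<open>f\<close>, the covariance is the integral of \<open>g (t / r^(1/d)) * (r * f r)\<close>, and
  the substitution \<open>r \<mapsto> r / (norm t)^d\<close> turns the claimed main term into the same integral with
  \<open>r * f r\<close> replaced by \<open>c * r^(-\<alpha>)\<close> (\<open>angular_function_rescaled\<close>). Both integrands vanish for
  \<open>r \<le> (norm t / 4)^d\<close>, and beyond this point the relative difference of \<open>r * f r\<close> and
  \<open>c * r^(-\<alpha>)\<close> is uniformly small once \<open>t\<close> is large. Finally \<open>Leb \<Xi> \<le> V * R\<close> gives the second
  moment.
\<close>

section \<open>Lebesgue integrals\<close>

lemma nn_integral_lborel_affine:
  fixes t :: "'a::euclidean_space"
  assumes [measurable]: "f \<in> borel_measurable borel" and "c \<noteq> 0"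
  shows "(\<integral>\<^sup>+x. f x \<partial>lborel) = ennreal (\<bar>c\<bar> ^ DIM('a)) * (\<integral>\<^sup>+x. f (t + c *\<^sub>R x) \<partial>lborel)"
  by (subst lborel_affine[OF \<open>c \<noteq> 0\<close>, of t])
    (simp add: nn_integral_density nn_integral_distr nn_integral_cmult)

lemma nn_integral_lborel_translate_reflect:
  fixes f :: "'a::euclidean_space \<Rightarrow> ennreal"
  assumes [measurable]: "f \<in> borel_measurable borel"
  shows "(\<integral>\<^sup>+x. f (t - x) \<partial>lborel) = (\<integral>\<^sup>+x. f x \<partial>lborel)"
  using nn_integral_lborel_affine[OF assms, of "-1" t] by simp

lemma integral_enn2real:
  assumes [measurable]: "f \<in> borel_measurable M" and fin: "(\<integral>\<^sup>+x. f x \<partial>M) < \<infinity>"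
  shows "integrable M (\<lambda>x. enn2real (f x))" "(\<integral>x. enn2real (f x) \<partial>M) = enn2real (\<integral>\<^sup>+x. f x \<partial>M)"
proof -
  have "AE x in M. f x \<noteq> \<infinity>"
    using fin by (intro nn_integral_PInf_AE) auto
  then have eq: "(\<integral>\<^sup>+x. ennreal (enn2real (f x)) \<partial>M) = (\<integral>\<^sup>+x. f x \<partial>M)"
    by (intro nn_integral_cong_AE) (auto simp: less_top)
  show "integrable M (\<lambda>x. enn2real (f x))"
    by (rule integrableI_nonneg) (use eq fin in auto)
  show "(\<integral>x. enn2real (f x) \<partial>M) = enn2real (\<integral>\<^sup>+x. f x \<partial>M)"
    unfolding eq[symmetric] by (rule integral_eq_nn_integral) auto
qed

text \<open>A function that is not integrable has integral \<open>0\<close>, which also respects the bound \<open>B\<close>.\<close>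

lemma integral_le_nn_integral_bound:
  fixes h :: "'w \<Rightarrow> real"
  assumes "AE \<omega> in M. 0 \<le> h \<omega>" "AE \<omega> in M. ennreal (h \<omega>) \<le> b \<omega>"
    and "(\<integral>\<^sup>+\<omega>. b \<omega> \<partial>M) \<le> ennreal B" "0 \<le> B"
  shows "(\<integral>\<omega>. h \<omega> \<partial>M) \<le> B"
proof (cases "integrable M h")
  case True
  have "ennreal (\<integral>\<omega>. h \<omega> \<partial>M) = (\<integral>\<^sup>+\<omega>. ennreal (h \<omega>) \<partial>M)"
    by (rule nn_integral_eq_integral[symmetric]) (use True assms(1) in auto)
  also have "\<dots> \<le> ennreal B"
    using nn_integral_mono_AE[OF assms(2)] assms(3) by order
  finally show ?thesis using \<open>0 \<le> B\<close> by simp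
qed (use \<open>0 \<le> B\<close> in \<open>simp add: not_integrable_integral_eq\<close>)

lemma nn_integral_powr_tail:
  fixes a \<alpha> :: real
  assumes "0 < a" "1 < \<alpha>"
  shows "(\<integral>\<^sup>+x. ennreal (x powr (- \<alpha>)) * indicator {a..} x \<partial>lborel) = ennreal (a powr (1 - \<alpha>) / (\<alpha> - 1))"
proof -
  have "((\<lambda>x. x powr (- \<alpha>)) has_integral - (a powr (- \<alpha> + 1)) / (- \<alpha> + 1)) {a..}"
    using assms by (intro has_integral_powr_to_inf) auto
  moreover have "- (a powr (- \<alpha> + 1)) / (- \<alpha> + 1) = a powr (1 - \<alpha>) / (\<alpha> - 1)"
    using assms by (simp add: field_simps)
  ultimately have "((\<lambda>x. x powr (- \<alpha>)) has_integral a powr (1 - \<alpha>) / (\<alpha> - 1)) {a..}"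
    by simp
  then have "(\<integral>\<^sup>+x. ennreal (indicator {a..} x * x powr (- \<alpha>)) \<partial>lborel) = ennreal (a powr (1 - \<alpha>) / (\<alpha> - 1))"
    by (intro nn_integral_has_integral_lebesgue) auto
  then show ?thesis
    by (simp add: ennreal_mult ennreal_indicator mult.commute)
qed

section \<open>Measurability in the Fell space\<close>

lemma openin_fell_topology_subset:
  "openin fell_topology U \<Longrightarrow> U \<subseteq> {F. closed F}"
  using openin_subset[of fell_topology U] by (auto simp: fell_topology_def)

lemma space_fell_borel: "space fell_borel = {F. closed F}"
  unfolding fell_borel_def by (rule space_measure_of) (use openin_fell_topology_subset in blast)

lemma sets_fell_borel_miss_compact:
  assumes "compact K"
  shows "{F. closed F \<and> F \<inter> K = {}} \<in> sets fell_borel"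
proof -
  have "openin fell_topology {F. closed F \<and> F \<inter> K = {}}"
    unfolding fell_topology_def by (rule topology_generated_by_Basis) (use assms in blast)
  moreover have "sets fell_borel = sigma_sets {F. closed F} {U. openin fell_topology U}"
    unfolding fell_borel_def
    by (rule sets_measure_of) (use openin_fell_topology_subset in blast)
  ultimately show ?thesis by auto
qed

text \<open>The complement of the membership relation is open: a point outside a closed set \<open>F\<close> lies in a
  small ball, centred in a countable dense set, whose closure misses \<open>F\<close>, and missing a compact ball
  is a basic Fell event.\<close>

lemma measurable_mem_fell_borel_pair:
  "Measurable.pred (fell_borel \<Otimes>\<^sub>M (borel :: 'a::euclidean_space measure)) (\<lambda>(F, x). x \<in> F)"
proof -
  obtain D :: "'a set" where D: "countable D" "\<And>X. open X \<Longrightarrow> X \<noteq> {} \<Longrightarrow> \<exists>d\<in>D. d \<in> X"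
    using countable_dense_setE by blast
  let ?r = "\<lambda>n::nat. 1 / (1 + real n)"
  let ?C = "\<Union>d\<in>D. \<Union>n. {F. closed F \<and> F \<inter> cball d (?r n) = {}} \<times> ball d (?r n)"
  have far: "\<exists>d\<in>D. \<exists>n. F \<inter> cball d (?r n) = {} \<and> x \<in> ball d (?r n)" if F: "closed F" "x \<notin> F" for F x
  proof -
    obtain e where e: "e > 0" "ball x e \<subseteq> - F"
      using F by (metis ComplI open_Compl open_contains_ball)
    obtain n where n: "?r n < e / 2"
      using reals_Archimedean[of "e / 2"] e(1) by (auto simp: inverse_eq_divide)
    obtain d where d: "d \<in> D" "d \<in> ball x (?r n)"
      using D(2)[of "ball x (?r n)"] by auto
    have "cball d (?r n) \<subseteq> ball x e"
    proof
      fix y assume "y \<in> cball d (?r n)"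
      then have "dist x y < e"
        using d(2) n dist_triangle[of x y d] by (auto simp: dist_commute)
      then show "y \<in> ball x e" by simp
    qed
    with e(2) d show ?thesis
      by (intro bexI[of _ d] exI[of _ n]) (auto simp: dist_commute)
  qed
  have "{z \<in> space (fell_borel \<Otimes>\<^sub>M borel). case z of (F, x) \<Rightarrow> x \<in> F}
      = space (fell_borel \<Otimes>\<^sub>M (borel :: 'a measure)) - ?C"
  proof -
    have "x \<in> F \<longleftrightarrow> (F, x) \<notin> ?C" if "closed F" for F x
      using far[OF that, of x] that by (cases "x \<in> F") auto
    then show ?thesis
      unfolding space_pair_measure space_fell_borel by (intro set_eqI) (simp only: mem_Collect_eq split_paired_all
          Diff_iff prod.case mem_Sigma_iff space_borel UNIV_I, blast)
  qed
  also have "\<dots> \<in> sets (fell_borel \<Otimes>\<^sub>M borel)"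
  proof (rule sets.Diff[OF sets.top], rule sets.countable_UN''[OF D(1)], rule sets.countable_UN''[OF countableI_type])
    fix d :: 'a and n :: nat
    show "{F. closed F \<and> F \<inter> cball d (?r n) = {}} \<times> ball d (?r n) \<in> sets (fell_borel \<Otimes>\<^sub>M borel)"
      by (intro pair_measureI sets_fell_borel_miss_compact) auto
  qed
  finally show ?thesis by (simp add: pred_def)
qed

lemma measurable_mem_fell_borel [measurable (raw)]:
  fixes g :: "'w \<Rightarrow> 'a::euclidean_space"
  assumes "f \<in> M \<rightarrow>\<^sub>M fell_borel" "g \<in> borel_measurable M"
  shows "Measurable.pred M (\<lambda>\<omega>. g \<omega> \<in> f \<omega>)"
  using measurable_compose[OF measurable_Pair[OF assms] measurable_mem_fell_borel_pair] by simp

lemma sets_borel_if_closed_fell [simp]: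
  "F \<in> space fell_borel \<Longrightarrow> F \<in> sets borel"
  by (simp add: space_fell_borel)

lemma random_closed_set_closed:
  assumes "random_closed_set M \<Xi>" "\<omega> \<in> space M"
  shows "closed (\<Xi> \<omega>)"
  using assms measurable_space[of \<Xi> M fell_borel \<omega>] by (simp add: random_closed_set_def space_fell_borel)

section \<open>Moments of the Poisson process\<close>

lemma measurable_point_count:
  assumes [measurable]: "\<And>j. u j \<in> borel_measurable N" "A \<in> sets borel"
  shows "point_count u A = (\<lambda>\<omega>. \<Sum>j. indicator A (u j \<omega>))"
    "point_count u A \<in> borel_measurable N"
proof -
  show *: "point_count u A = (\<lambda>\<omega>. \<Sum>j. indicator A (u j \<omega>))"
  proof
    fix \<omega>
    have "(\<Sum>j. indicator A (u j \<omega>) :: ennreal) = (\<integral>\<^sup>+j. indicator {j. u j \<omega> \<in> A} j \<partial>count_space UNIV)"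
      by (simp add: nn_integral_count_space_nat indicator_def)
    then show "point_count u A \<omega> = (\<Sum>j. indicator A (u j \<omega>))"
      by (simp add: point_count_def)
  qed
  show "point_count u A \<in> borel_measurable N"
    unfolding * by measurable
qed

lemma point_count_split:
  "point_count u A \<omega> = point_count u (A - B) \<omega> + point_count u (A \<inter> B) \<omega>"
  unfolding point_count_def
  by (subst plus_emeasure) (auto intro!: arg_cong[where f="emeasure (count_space UNIV)"])

lemma poisson_sums:
  fixes m :: real
  shows "(\<lambda>k. exp (- m) * m ^ k / fact k) sums 1"
    "(\<lambda>k. real k * (exp (- m) * m ^ k / fact k)) sums m"
    "(\<lambda>k. (real k)\<^sup>2 * (exp (- m) * m ^ k / fact k)) sums (m\<^sup>2 + m)"
proof -
  let ?p = "\<lambda>k. exp (- m) * m ^ k / fact k"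
  have "(\<lambda>k. m ^ k / fact k) sums exp m"
    using exp_converges[of m] by (simp add: divide_inverse mult.commute)
  then have "(\<lambda>k. exp (- m) * (m ^ k / fact k)) sums (exp (- m) * exp m)"
    by (rule sums_mult)
  then show p: "?p sums 1" by (simp add: mult_exp_exp)
  have shift: "real (Suc k) * ?p (Suc k) = m * ?p k" for k
    by (simp add: field_simps del: of_nat_Suc)
  have "(\<lambda>k. real (Suc k) * ?p (Suc k)) sums m"
    unfolding shift using sums_mult[OF p, of m] by simp
  then show 1: "(\<lambda>k. real k * ?p k) sums m"
    by (subst (asm) sums_Suc_iff) simp
  have "(real (Suc k))\<^sup>2 * ?p (Suc k) = m * (real k * ?p k) + m * ?p k" for k
    using shift[of k] by (simp add: power2_eq_square mult.assoc distrib_right del: of_nat_Suc)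
      (simp add: algebra_simps add_divide_distrib)
  moreover have "(\<lambda>k. m * (real k * ?p k) + m * ?p k) sums (m * m + m * 1)"
    by (intro sums_add sums_mult 1 p)
  ultimately have "(\<lambda>k. (real (Suc k))\<^sup>2 * ?p (Suc k)) sums (m\<^sup>2 + m)"
    by (simp add: power2_eq_square)
  then show "(\<lambda>k. (real k)\<^sup>2 * ?p k) sums (m\<^sup>2 + m)"
    by (subst (asm) sums_Suc_iff) simp
qed

text \<open>Since the \<open>p k\<close> sum to \<open>1\<close>, the variable \<open>Z\<close> is almost surely a finite natural number, even
  though \<open>\<infinity>\<close> is a possible value.\<close>

lemma nn_integral_nat_valued:
  fixes Z :: "'w \<Rightarrow> ennreal"
  assumes "prob_space N" and [measurable]: "Z \<in> borel_measurable N" "g \<in> borel_measurable borel"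
    and p: "\<And>k. measure N {\<omega> \<in> space N. Z \<omega> = of_nat k} = p k" "p sums 1"
  shows "(\<integral>\<^sup>+\<omega>. g (Z \<omega>) \<partial>N) = (\<Sum>k::nat. g (of_nat k) * ennreal (p k))"
proof -
  interpret prob_space N by fact
  let ?E = "\<lambda>k::nat. {\<omega> \<in> space N. Z \<omega> = of_nat k}"
  have E: "?E k \<in> events" for k
  proof -
    have "?E k = Z -` {of_nat k} \<inter> space N" by auto
    also have "\<dots> \<in> events" by (rule measurable_sets[OF assms(2)]) simp
    finally show ?thesis .
  qed
  have disj: "disjoint_family ?E" by (auto simp: disjoint_family_on_def)
  have "(\<lambda>k. prob (?E k)) sums prob (\<Union>k. ?E k)"
    by (rule finite_measure_UNION) (use E disj in auto)
  with p have "prob (\<Union>k. ?E k) = 1"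
    using sums_unique2 by auto
  then have AE: "AE \<omega> in N. \<omega> \<in> (\<Union>k. ?E k)"
    by (subst AE_in_set_eq_1) (use E in auto)
  have "(\<integral>\<^sup>+\<omega>. g (Z \<omega>) \<partial>N) = (\<integral>\<^sup>+\<omega>. (\<Sum>k. g (of_nat k) * indicator (?E k) \<omega>) \<partial>N)"
  proof (rule nn_integral_cong_AE)
    show "AE \<omega> in N. g (Z \<omega>) = (\<Sum>k. g (of_nat k) * indicator (?E k) \<omega>)"
      using AE
    proof eventually_elim
      fix \<omega> assume "\<omega> \<in> (\<Union>k. ?E k)"
      then obtain k where k: "\<omega> \<in> ?E k" by auto
      then have "(\<Sum>k. g (of_nat k) * indicator (?E k) \<omega>)
          = (\<Sum>j\<in>{k}. g (of_nat j) * indicator (?E j) \<omega>)"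
        by (intro suminf_finite) auto
      with k show "g (Z \<omega>) = (\<Sum>k. g (of_nat k) * indicator (?E k) \<omega>)" by simp
    qed
  qed
  also have "\<dots> = (\<Sum>k. g (of_nat k) * ennreal (p k))"
    using p(1) by (simp add: nn_integral_suminf nn_integral_cmult_indicator E emeasure_eq_measure)
  finally show ?thesis .
qed

lemma nn_integral_poisson_count:
  assumes P: "unit_poisson_process N u" and A: "A \<in> sets borel" "bounded A"
  shows "(\<integral>\<^sup>+\<omega>. point_count u A \<omega> \<partial>N) = emeasure lborel A"
    and "(\<integral>\<^sup>+\<omega>. (point_count u A \<omega>)\<^sup>2 \<partial>N) = (emeasure lborel A)\<^sup>2 + emeasure lborel A"
proof -
  have N: "prob_space N" and u[measurable]: "\<And>j. u j \<in> borel_measurable N"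
    using P by (auto simp: unit_poisson_process_def)
  define m where "m = measure lborel A"
  have m: "emeasure lborel A = ennreal m" "0 \<le> m"
    using emeasure_bounded_finite[OF A(2)] A by (auto simp: m_def emeasure_eq_ennreal_measure top.not_eq_extremum)
  let ?p = "\<lambda>k. exp (- m) * m ^ k / fact k"
  have p: "measure N {\<omega> \<in> space N. point_count u A \<omega> = of_nat k} = ?p k" for k
    using P A by (simp add: unit_poisson_process_def m_def)
  have int: "(\<integral>\<^sup>+\<omega>. g (point_count u A \<omega>) \<partial>N) = (\<Sum>k::nat. g (of_nat k) * ennreal (?p k))"
    if "g \<in> borel_measurable borel" for g
    by (rule nn_integral_nat_valued)
      (use N measurable_point_count(2)[OF u A(1)] p poisson_sums(1)[of m] that in auto)
  have "(\<integral>\<^sup>+\<omega>. point_count u A \<omega> \<partial>N) = (\<Sum>k::nat. ennreal (real k * ?p k))"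
    using m(2) by (subst int, simp) (simp only: ennreal_of_nat_eq_real_of_nat ennreal_mult' of_nat_0_le_iff)
  also have "\<dots> = ennreal m"
    using poisson_sums(2)[of m] m(2) by (intro suminf_ennreal_eq) auto
  finally show "(\<integral>\<^sup>+\<omega>. point_count u A \<omega> \<partial>N) = emeasure lborel A" by (simp add: m)
  have "(\<integral>\<^sup>+\<omega>. (point_count u A \<omega>)\<^sup>2 \<partial>N) = (\<Sum>k::nat. ennreal ((real k)\<^sup>2 * ?p k))"
    using m(2) by (subst int, simp)
      (simp only: ennreal_of_nat_eq_real_of_nat ennreal_mult' ennreal_power of_nat_0_le_iff zero_le_power2)
  also have "\<dots> = ennreal (m\<^sup>2 + m)"
    using poisson_sums(3)[of m] m(2) by (intro suminf_ennreal_eq) auto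
  finally show "(\<integral>\<^sup>+\<omega>. (point_count u A \<omega>)\<^sup>2 \<partial>N) = (emeasure lborel A)\<^sup>2 + emeasure lborel A"
    using m by (simp add: ennreal_power)
qed

lemma nn_integral_poisson_count_disjoint:
  assumes P: "unit_poisson_process N u"
    and A: "A \<in> sets borel" "bounded A" and B: "B \<in> sets borel" "bounded B" and "A \<inter> B = {}"
  shows "(\<integral>\<^sup>+\<omega>. point_count u A \<omega> * point_count u B \<omega> \<partial>N) = emeasure lborel A * emeasure lborel B"
proof -
  interpret prob_space N using P by (auto simp: unit_poisson_process_def)
  define C where "C = case_nat A (\<lambda>_::nat. B)"
  have "disjoint_family_on C {..<2}"
    using \<open>A \<inter> B = {}\<close> by (auto simp: disjoint_family_on_def C_def split: nat.split)
  moreover have "\<forall>i<2. C i \<in> sets borel \<and> bounded (C i)"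
    using A B by (auto simp: C_def split: nat.split)
  ultimately have ind: "indep_vars (\<lambda>_. borel) (\<lambda>i. point_count u (C i)) {..<2}"
    using P unfolding unit_poisson_process_def by blast
  have "(\<integral>\<^sup>+\<omega>. (\<Prod>i<2. point_count u (C i) \<omega>) \<partial>N) = (\<Prod>i<2. \<integral>\<^sup>+\<omega>. point_count u (C i) \<omega> \<partial>N)"
    by (rule indep_vars_nn_integral) (use ind in auto)
  then show ?thesis
    using nn_integral_poisson_count(1)[OF P A] nn_integral_poisson_count(1)[OF P B]
    by (simp add: C_def numeral_2_eq_2)
qed

text \<open>\<open>A\<close> and \<open>B\<close> share the part \<open>A \<inter> B\<close>; cutting both along it leaves products of counts in disjoint
  sets, which are independent, and the square of one Poisson variable, whose variance produces the
  last summand.\<close>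

lemma nn_integral_poisson_count_mult:
  assumes P: "unit_poisson_process N u"
    and A[measurable]: "A \<in> sets borel" and "bounded A" and B[measurable]: "B \<in> sets borel" and "bounded B"
  shows "(\<integral>\<^sup>+\<omega>. point_count u A \<omega> * point_count u B \<omega> \<partial>N)
    = emeasure lborel A * emeasure lborel B + emeasure lborel (A \<inter> B)"
proof -
  have u[measurable]: "\<And>j. u j \<in> borel_measurable N"
    using P by (auto simp: unit_poisson_process_def)
  let ?n = "point_count u" and ?C = "A \<inter> B"
  have bdd: "bounded (A - B)" "bounded (B - A)" "bounded ?C"
    using \<open>bounded A\<close> \<open>bounded B\<close> bounded_subset by blast+
  note [measurable] = measurable_point_count(2)[OF u]
  have nA: "?n A \<omega> = ?n (A - B) \<omega> + ?n ?C \<omega>" and nB: "?n B \<omega> = ?n (B - A) \<omega> + ?n ?C \<omega>" for \<omega>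
    using point_count_split[of u A \<omega> B] point_count_split[of u B \<omega> A] by (simp_all add: Int_commute)
  have "?n A \<omega> * ?n B \<omega> = ?n (A - B) \<omega> * ?n (B - A) \<omega> + ?n (A - B) \<omega> * ?n ?C \<omega>
      + ?n (B - A) \<omega> * ?n ?C \<omega> + (?n ?C \<omega>)\<^sup>2" for \<omega>
    unfolding nA nB by (simp add: algebra_simps power2_eq_square)
  moreover have "(A - B) \<inter> (B - A) = {}" "(A - B) \<inter> ?C = {}" "(B - A) \<inter> ?C = {}"
    by auto
  ultimately have eq: "(\<integral>\<^sup>+\<omega>. ?n A \<omega> * ?n B \<omega> \<partial>N)
      = emeasure lborel (A - B) * emeasure lborel (B - A) + emeasure lborel (A - B) * emeasure lborel ?C
        + emeasure lborel (B - A) * emeasure lborel ?C + ((emeasure lborel ?C)\<^sup>2 + emeasure lborel ?C)"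
    using bdd by (simp add: nn_integral_add nn_integral_poisson_count[OF P]
        nn_integral_poisson_count_disjoint[OF P])
  have "emeasure lborel A = emeasure lborel (A - B) + emeasure lborel ?C"
    by (subst plus_emeasure) (auto intro!: arg_cong[where f="emeasure lborel"])
  moreover have "emeasure lborel B = emeasure lborel (B - A) + emeasure lborel ?C"
    by (subst plus_emeasure) (auto intro!: arg_cong[where f="emeasure lborel"])
  ultimately show ?thesis
    unfolding eq by (simp add: distrib_left distrib_right power2_eq_square ac_simps)
qed

text \<open>Both sides are measures when \<open>q\<close> runs through the indicators, so it is enough to compare them on
  boxes. Campbell's formula is the case \<open>Y = 1\<close>, and the product moment follows from two further
  applications, in which \<open>Y\<close> is first a count and then a sum over the points.\<close>

lemma nn_integral_poisson_weighted_sum: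
  fixes u :: "nat \<Rightarrow> 'w \<Rightarrow> 'a::euclidean_space"
  assumes "prob_space N" and [measurable]: "\<And>j. u j \<in> borel_measurable N"
    and [measurable]: "Y \<in> borel_measurable N" "h \<in> borel_measurable borel" "q \<in> borel_measurable borel"
    and box: "\<And>a b. (\<integral>\<^sup>+\<omega>. Y \<omega> * point_count u (box a b) \<omega> \<partial>N) = (\<integral>\<^sup>+x. h x * indicator (box a b) x \<partial>lborel)"
    and fin: "\<And>a b. (\<integral>\<^sup>+x. h x * indicator (box a b) x \<partial>lborel) < \<infinity>"
  shows "(\<integral>\<^sup>+\<omega>. Y \<omega> * (\<Sum>j. q (u j \<omega>)) \<partial>N) = (\<integral>\<^sup>+x. h x * q x \<partial>lborel)"
proof -
  interpret prob_space N by fact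
  interpret P: pair_sigma_finite "count_space (UNIV :: nat set)" N
    by (intro pair_sigma_finite.intro sigma_finite_measure_count_space_countable)
      (auto intro: sigma_finite_measure_axioms)
  have [measurable]: "(\<lambda>(j, \<omega>). u j \<omega>) \<in> borel_measurable (count_space UNIV \<Otimes>\<^sub>M N)"
    by (rule measurable_pair_measure_countable1) auto
  \<comment> \<open>the mean measure of the points, each outcome being weighted by \<open>Y\<close>\<close>
  define \<mu> where "\<mu> = distr (density (count_space UNIV \<Otimes>\<^sub>M N) (\<lambda>(j, \<omega>). Y \<omega>)) borel (\<lambda>(j, \<omega>). u j \<omega>)"
  have int: "(\<integral>\<^sup>+x. g x \<partial>\<mu>) = (\<integral>\<^sup>+\<omega>. Y \<omega> * (\<Sum>j. g (u j \<omega>)) \<partial>N)"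
    if [measurable]: "g \<in> borel_measurable borel" for g
  proof -
    have "(\<integral>\<^sup>+x. g x \<partial>\<mu>) = (\<integral>\<^sup>+z. Y (snd z) * g (u (fst z) (snd z)) \<partial>(count_space UNIV \<Otimes>\<^sub>M N))"
      unfolding \<mu>_def by (subst nn_integral_distr, simp, simp, subst nn_integral_density)
        (auto simp: case_prod_beta')
    also have "\<dots> = (\<integral>\<^sup>+j. \<integral>\<^sup>+\<omega>. Y \<omega> * g (u j \<omega>) \<partial>N \<partial>count_space UNIV)"
      by (subst nn_integral_fst[symmetric]) (auto simp: case_prod_beta')
    also have "\<dots> = (\<integral>\<^sup>+\<omega>. Y \<omega> * (\<Sum>j. g (u j \<omega>)) \<partial>N)"
      by (simp add: nn_integral_count_space_nat nn_integral_suminf[symmetric])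
    finally show ?thesis .
  qed
  have "\<mu> = density lborel h"
  proof (rule measure_eqI_generator_eq)
    let ?E = "range (\<lambda>(a, b). box a b :: 'a set)"
    let ?A = "\<lambda>n::nat. box (- (real n *\<^sub>R One)) (real n *\<^sub>R One) :: 'a set"
    show "Int_stable ?E" by (auto simp: Int_stable_def box_Int_box)
    show "?E \<subseteq> Pow UNIV" "sets \<mu> = sigma_sets UNIV ?E" "sets (density lborel h) = sigma_sets UNIV ?E"
      by (simp_all add: borel_eq_box \<mu>_def)
    show "range ?A \<subseteq> ?E" "(\<Union>i. ?A i) = UNIV"
      unfolding UN_box_eq_UNIV by auto
    have eq: "emeasure \<mu> (box a b) = (\<integral>\<^sup>+x. h x * indicator (box a b) x \<partial>lborel)" for a b
    proof -
      have "emeasure \<mu> (box a b) = (\<integral>\<^sup>+x. indicator (box a b) x \<partial>\<mu>)"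
        by (simp add: \<mu>_def)
      also have "\<dots> = (\<integral>\<^sup>+\<omega>. Y \<omega> * point_count u (box a b) \<omega> \<partial>N)"
        by (subst int) (simp_all add: measurable_point_count(1)[where N=N])
      finally show ?thesis by (simp add: box)
    qed
    show "emeasure \<mu> X = emeasure (density lborel h) X" if "X \<in> ?E" for X
      using that by (auto simp: eq emeasure_density)
    show "emeasure \<mu> (?A i) \<noteq> \<infinity>" for i
      using fin by (simp add: eq less_top)
  qed
  then have "(\<integral>\<^sup>+x. q x \<partial>\<mu>) = (\<integral>\<^sup>+x. h x * q x \<partial>lborel)"
    by (simp add: nn_integral_density)
  then show ?thesis by (simp add: int)
qed

lemma nn_integral_poisson_sum:
  fixes u :: "nat \<Rightarrow> 'w \<Rightarrow> 'a::euclidean_space"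
  assumes P: "unit_poisson_process N u" and q: "q \<in> borel_measurable borel"
  shows "(\<integral>\<^sup>+\<omega>. (\<Sum>j. q (u j \<omega>)) \<partial>N) = (\<integral>\<^sup>+x. q x \<partial>lborel)"
proof -
  have "(\<integral>\<^sup>+\<omega>. 1 * (\<Sum>j. q (u j \<omega>)) \<partial>N) = (\<integral>\<^sup>+x. 1 * q x \<partial>lborel)"
  proof (rule nn_integral_poisson_weighted_sum)
    fix a b :: 'a
    show "(\<integral>\<^sup>+\<omega>. 1 * point_count u (box a b) \<omega> \<partial>N) = (\<integral>\<^sup>+x. 1 * indicator (box a b) x \<partial>lborel)"
      using nn_integral_poisson_count(1)[OF P, of "box a b"] by (simp del: emeasure_lborel_box_eq)
    show "(\<integral>\<^sup>+x. 1 * indicator (box a b) x \<partial>lborel) < (\<infinity> :: ennreal)"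
      using emeasure_lborel_box_finite[of a b] by (simp del: emeasure_lborel_box_eq)
  qed (use P q in \<open>auto simp: unit_poisson_process_def\<close>)
  then show ?thesis by simp
qed

lemma nn_integral_poisson_sum_mult:
  fixes u :: "nat \<Rightarrow> 'w \<Rightarrow> 'a::euclidean_space"
  assumes P: "unit_poisson_process N u"
    and [measurable]: "p \<in> borel_measurable borel" "q \<in> borel_measurable borel"
    and fin: "(\<integral>\<^sup>+x. p x \<partial>lborel) < \<infinity>"
  shows "(\<integral>\<^sup>+\<omega>. (\<Sum>j. p (u j \<omega>)) * (\<Sum>j. q (u j \<omega>)) \<partial>N)
    = (\<integral>\<^sup>+x. p x \<partial>lborel) * (\<integral>\<^sup>+x. q x \<partial>lborel) + (\<integral>\<^sup>+x. p x * q x \<partial>lborel)"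
proof -
  have N: "prob_space N" and u[measurable]: "\<And>j. u j \<in> borel_measurable N"
    using P by (auto simp: unit_poisson_process_def)
  have [measurable]: "point_count u (box a b) \<in> borel_measurable N" for a b
    by (rule measurable_point_count(2)) auto
  let ?m = "\<integral>\<^sup>+x. p x \<partial>lborel"
  have box: "(\<integral>\<^sup>+\<omega>. point_count u (box a b) \<omega> * (\<Sum>j. p (u j \<omega>)) \<partial>N)
      = (\<integral>\<^sup>+x. (?m + p x) * indicator (box a b) x \<partial>lborel)" for a b
  proof -
    let ?B = "box a b"
    have "(\<integral>\<^sup>+\<omega>. point_count u ?B \<omega> * (\<Sum>j. p (u j \<omega>)) \<partial>N)
        = (\<integral>\<^sup>+x. (emeasure lborel ?B + indicator ?B x) * p x \<partial>lborel)"
    proof (rule nn_integral_poisson_weighted_sum[OF N])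
      fix c d
      have top: "emeasure lborel (box x y) \<noteq> \<top>" for x y :: 'a
        using emeasure_lborel_box_finite[of x y] by (simp add: less_top)
      have "(\<integral>\<^sup>+x. (emeasure lborel ?B + indicator ?B x) * indicator (box c d) x \<partial>lborel)
          = emeasure lborel ?B * emeasure lborel (box c d) + emeasure lborel (?B \<inter> box c d)"
        by (simp add: distrib_right nn_integral_add nn_integral_cmult_indicator indicator_inter_arith[symmetric]
            del: emeasure_lborel_box_eq)
      then show "(\<integral>\<^sup>+\<omega>. point_count u ?B \<omega> * point_count u (box c d) \<omega> \<partial>N)
          = (\<integral>\<^sup>+x. (emeasure lborel ?B + indicator ?B x) * indicator (box c d) x \<partial>lborel)"
          "(\<integral>\<^sup>+x. (emeasure lborel ?B + indicator ?B x) * indicator (box c d) x \<partial>lborel) < \<infinity>"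
        by (simp_all add: nn_integral_poisson_count_mult[OF P] box_Int_box top
            ennreal_mult_eq_top_iff less_top[symmetric] del: emeasure_lborel_box_eq)
    qed auto
    then show ?thesis
      by (simp add: distrib_right nn_integral_add nn_integral_cmult nn_integral_multc nn_integral_cmult_indicator
          mult.commute[of "indicator _ _"] mult.commute[of "emeasure lborel _"])
  qed
  have "(\<integral>\<^sup>+\<omega>. (\<Sum>j. p (u j \<omega>)) * (\<Sum>j. q (u j \<omega>)) \<partial>N) = (\<integral>\<^sup>+x. (?m + p x) * q x \<partial>lborel)"
  proof (rule nn_integral_poisson_weighted_sum[OF N])
    fix a b
    have "(\<integral>\<^sup>+x. p x * indicator (box a b) x \<partial>lborel) \<le> ?m"
      by (intro nn_integral_mono) (simp add: indicator_def)
    then have "(\<integral>\<^sup>+x. (?m + p x) * indicator (box a b) x \<partial>lborel)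
        \<le> ?m * emeasure lborel (box a b) + ?m"
      by (simp add: distrib_right nn_integral_add nn_integral_cmult_indicator
          add_left_mono del: emeasure_lborel_box_eq)
    also have "\<dots> < \<infinity>"
      using fin emeasure_lborel_box_finite[of a b]
      by (simp add: ennreal_mult_less_top del: emeasure_lborel_box_eq)
    finally show "(\<integral>\<^sup>+x. (?m + p x) * indicator (box a b) x \<partial>lborel) < \<infinity>" .
    show "(\<integral>\<^sup>+\<omega>. (\<Sum>j. p (u j \<omega>)) * point_count u (box a b) \<omega> \<partial>N)
        = (\<integral>\<^sup>+x. (?m + p x) * indicator (box a b) x \<partial>lborel)"
      using box by (simp add: mult.commute)
  qed auto
  then show ?thesis
    by (simp add: distrib_right nn_integral_add nn_integral_cmult)
qed

section \<open>Covariance of the random grain model\<close>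

text \<open>The joint law of independent variables is the product of their laws; the inner integral runs over
  an independent copy of \<open>Y\<close>.\<close>

lemma indep_rvs_nn_integral:
  assumes "prob_space M" and ind: "indep_rvs M A X B Y"
    and [measurable]: "\<Phi> \<in> borel_measurable (A \<Otimes>\<^sub>M B)"
  shows "(\<integral>\<^sup>+\<omega>. \<Phi> (X \<omega>, Y \<omega>) \<partial>M) = (\<integral>\<^sup>+\<omega>. \<integral>\<^sup>+\<omega>'. \<Phi> (X \<omega>, Y \<omega>') \<partial>M \<partial>M)"
proof -
  interpret prob_space M by fact
  have [measurable]: "X \<in> measurable M A" "Y \<in> measurable M B"
    and set: "indep_set {X -` S \<inter> space M |S. S \<in> sets A} {Y -` S \<inter> space M |S. S \<in> sets B}"
    using ind by (auto simp: indep_rvs_def)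
  interpret X: prob_space "distr M A X" by (rule prob_space_distr) simp
  interpret Y: prob_space "distr M B Y" by (rule prob_space_distr) simp
  have "distr M A X \<Otimes>\<^sub>M distr M B Y = distr M (A \<Otimes>\<^sub>M B) (\<lambda>\<omega>. (X \<omega>, Y \<omega>))"
  proof (rule pair_measure_eqI)
    fix S T assume "S \<in> sets (distr M A X)" "T \<in> sets (distr M B Y)"
    then have [measurable]: "S \<in> sets A" "T \<in> sets B" by auto
    have "prob ((X -` S \<inter> space M) \<inter> (Y -` T \<inter> space M)) = prob (X -` S \<inter> space M) * prob (Y -` T \<inter> space M)"
      by (rule indep_setD[OF set]) auto
    moreover have "(\<lambda>\<omega>. (X \<omega>, Y \<omega>)) -` (S \<times> T) \<inter> space M = (X -` S \<inter> space M) \<inter> (Y -` T \<inter> space M)"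
      by auto
    ultimately show "emeasure (distr M A X) S * emeasure (distr M B Y) T
        = emeasure (distr M (A \<Otimes>\<^sub>M B) (\<lambda>\<omega>. (X \<omega>, Y \<omega>))) (S \<times> T)"
      by (simp add: emeasure_distr emeasure_eq_measure ennreal_mult')
  qed (auto intro: X.sigma_finite_measure_axioms Y.sigma_finite_measure_axioms)
  then have "(\<integral>\<^sup>+\<omega>. \<Phi> (X \<omega>, Y \<omega>) \<partial>M) = (\<integral>\<^sup>+z. \<Phi> z \<partial>(distr M A X \<Otimes>\<^sub>M distr M B Y))"
    by (simp add: nn_integral_distr)
  also have "\<dots> = (\<integral>\<^sup>+x. \<integral>\<^sup>+y. \<Phi> (x, y) \<partial>distr M B Y \<partial>distr M A X)"
    by (rule Y.nn_integral_fst[symmetric]) simp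
  also have "\<dots> = (\<integral>\<^sup>+\<omega>. \<integral>\<^sup>+y. \<Phi> (X \<omega>, y) \<partial>distr M B Y \<partial>M)"
    by (subst nn_integral_distr) auto
  also have "\<dots> = (\<integral>\<^sup>+\<omega>. \<integral>\<^sup>+\<omega>'. \<Phi> (X \<omega>, Y \<omega>') \<partial>M \<partial>M)"
  proof (rule nn_integral_cong)
    fix \<omega> assume "\<omega> \<in> space M"
    then have "X \<omega> \<in> space A" by (rule measurable_space[rotated]) simp
    then show "(\<integral>\<^sup>+y. \<Phi> (X \<omega>, y) \<partial>distr M B Y) = (\<integral>\<^sup>+\<omega>'. \<Phi> (X \<omega>, Y \<omega>') \<partial>M)"
      by (subst nn_integral_distr) auto
  qed
  finally show ?thesis .
qed

lemma mem_shift_image: "x \<in> (\<lambda>y. y - t) ` F \<longleftrightarrow> x + t \<in> F" for t :: "'a::real_vector"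
  by (auto simp: image_iff algebra_simps intro: bexI[of _ "x + t"])

lemma sets_borel_overlap:
  fixes t :: "'a::euclidean_space"
  assumes F: "F \<in> sets borel"
  shows "F \<inter> (\<lambda>x. x - t) ` F \<in> sets borel"
proof -
  have "(\<lambda>x. x - t) ` F = (\<lambda>x. x + t) -` F \<inter> space borel"
    by (auto simp: mem_shift_image)
  also have "\<dots> \<in> sets borel" by (rule measurable_sets[OF _ F]) simp
  finally show ?thesis using F by auto
qed

lemma random_closed_set_borel:
  assumes "random_closed_set M \<Xi>" "\<omega> \<in> space M"
  shows "\<Xi> \<omega> \<in> sets borel"
  using random_closed_set_closed[OF assms] by simp

text \<open>Fubini's theorem for the indicator of \<open>x \<in> \<Xi> \<omega> \<and> x + t \<in> \<Xi> \<omega>\<close> on the product of space and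
  probability space.\<close>

lemma nn_integral_overlap_probability:
  fixes \<Xi> :: "'w \<Rightarrow> 'a::euclidean_space set"
  assumes \<Xi>: "random_closed_set M \<Xi>"
  shows "(\<integral>\<^sup>+x. emeasure M {\<omega> \<in> space M. x \<in> \<Xi> \<omega> \<and> x + t \<in> \<Xi> \<omega>} \<partial>lborel)
    = (\<integral>\<^sup>+\<omega>. emeasure lborel (\<Xi> \<omega> \<inter> (\<lambda>x. x - t) ` \<Xi> \<omega>) \<partial>M)"
proof -
  interpret prob_space M using \<Xi> by (simp add: random_closed_set_def)
  interpret pair_sigma_finite M "lborel :: 'a measure" ..
  have [measurable]: "\<Xi> \<in> M \<rightarrow>\<^sub>M fell_borel" using \<Xi> by (simp add: random_closed_set_def)
  let ?i = "\<lambda>\<omega> x. indicator (\<Xi> \<omega> \<inter> (\<lambda>x. x - t) ` \<Xi> \<omega>) x :: ennreal"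
  have i: "?i \<omega> x = of_bool (x \<in> \<Xi> \<omega> \<and> x + t \<in> \<Xi> \<omega>)" for \<omega> x
    by (simp add: indicator_def mem_shift_image)
  have "(\<integral>\<^sup>+x. emeasure M {\<omega> \<in> space M. x \<in> \<Xi> \<omega> \<and> x + t \<in> \<Xi> \<omega>} \<partial>lborel)
      = (\<integral>\<^sup>+x. \<integral>\<^sup>+\<omega>. ?i \<omega> x \<partial>M \<partial>lborel)"
  proof (rule nn_integral_cong)
    fix x
    have "emeasure M {\<omega> \<in> space M. x \<in> \<Xi> \<omega> \<and> x + t \<in> \<Xi> \<omega>}
        = (\<integral>\<^sup>+\<omega>. indicator {\<omega> \<in> space M. x \<in> \<Xi> \<omega> \<and> x + t \<in> \<Xi> \<omega>} \<omega> \<partial>M)"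
      by (rule nn_integral_indicator[symmetric]) measurable
    also have "\<dots> = (\<integral>\<^sup>+\<omega>. ?i \<omega> x \<partial>M)"
      by (intro nn_integral_cong) (simp add: i mem_shift_image indicator_def)
    finally show "emeasure M {\<omega> \<in> space M. x \<in> \<Xi> \<omega> \<and> x + t \<in> \<Xi> \<omega>} = (\<integral>\<^sup>+\<omega>. ?i \<omega> x \<partial>M)" .
  qed
  also have "\<dots> = (\<integral>\<^sup>+\<omega>. \<integral>\<^sup>+x. ?i \<omega> x \<partial>lborel \<partial>M)"
    unfolding i by (rule Fubini') measurable
  also have "\<dots> = (\<integral>\<^sup>+\<omega>. emeasure lborel (\<Xi> \<omega> \<inter> (\<lambda>x. x - t) ` \<Xi> \<omega>) \<partial>M)"
    by (intro nn_integral_cong nn_integral_indicator) (simp add: sets_borel_overlap random_closed_set_borel[OF \<Xi>])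
  finally show ?thesis .
qed

lemma measurable_emeasure_overlap [measurable (raw)]:
  fixes g :: "'w \<Rightarrow> 'a::euclidean_space"
  assumes [measurable]: "f \<in> M \<rightarrow>\<^sub>M fell_borel" "g \<in> borel_measurable M"
  shows "(\<lambda>\<omega>. emeasure lborel (f \<omega> \<inter> (\<lambda>x. x - g \<omega>) ` f \<omega>)) \<in> borel_measurable M"
proof -
  have "emeasure lborel (f \<omega> \<inter> (\<lambda>x. x - g \<omega>) ` f \<omega>)
      = (\<integral>\<^sup>+x. of_bool (x \<in> f \<omega> \<and> x + g \<omega> \<in> f \<omega>) \<partial>lborel)" if "\<omega> \<in> space M" for \<omega>
  proof -
    have "f \<omega> \<in> sets borel" using measurable_space[OF assms(1) that] by simp
    then have "emeasure lborel (f \<omega> \<inter> (\<lambda>x. x - g \<omega>) ` f \<omega>)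
        = (\<integral>\<^sup>+x. indicator (f \<omega> \<inter> (\<lambda>x. x - g \<omega>) ` f \<omega>) x \<partial>lborel)"
      by (intro nn_integral_indicator[symmetric]) (simp add: sets_borel_overlap)
    then show ?thesis
      by (simp add: mem_shift_image indicator_def cong: nn_integral_cong)
  qed
  moreover have "(\<lambda>\<omega>. \<integral>\<^sup>+x. of_bool (x \<in> f \<omega> \<and> x + g \<omega> \<in> f \<omega>) \<partial>lborel) \<in> borel_measurable M"
    by measurable
  ultimately show ?thesis by (simp cong: measurable_cong)
qed

lemma measurable_emeasure_fell_borel [measurable (raw)]:
  fixes f :: "'w \<Rightarrow> 'a::euclidean_space set"
  assumes [measurable]: "f \<in> M \<rightarrow>\<^sub>M fell_borel"
  shows "(\<lambda>\<omega>. emeasure lborel (f \<omega>)) \<in> borel_measurable M"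
  using measurable_emeasure_overlap[OF assms, of "\<lambda>_. 0"] by simp

lemma ennreal_mean_overlap:
  fixes \<Xi> :: "'w \<Rightarrow> 'a::euclidean_space set"
  assumes \<Xi>: "random_closed_set M \<Xi>" and fin: "(\<integral>\<^sup>+\<omega>. emeasure lborel (\<Xi> \<omega>) \<partial>M) < \<infinity>"
  shows "ennreal (mean_overlap M \<Xi> t) = (\<integral>\<^sup>+\<omega>. emeasure lborel (\<Xi> \<omega> \<inter> (\<lambda>x. x - t) ` \<Xi> \<omega>) \<partial>M)"
    and "(\<integral>\<^sup>+\<omega>. emeasure lborel (\<Xi> \<omega> \<inter> (\<lambda>x. x - t) ` \<Xi> \<omega>) \<partial>M) < \<infinity>"
    and "0 \<le> mean_overlap M \<Xi> t"
proof -
  let ?e = "\<lambda>\<omega>. emeasure lborel (\<Xi> \<omega> \<inter> (\<lambda>x. x - t) ` \<Xi> \<omega>)"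
  have [measurable]: "\<Xi> \<in> M \<rightarrow>\<^sub>M fell_borel" using \<Xi> by (simp add: random_closed_set_def)
  have "(\<integral>\<^sup>+\<omega>. ?e \<omega> \<partial>M) \<le> (\<integral>\<^sup>+\<omega>. emeasure lborel (\<Xi> \<omega>) \<partial>M)"
    by (intro nn_integral_mono emeasure_mono) (auto simp: sets_borel_overlap random_closed_set_borel[OF \<Xi>])
  with fin show lt: "(\<integral>\<^sup>+\<omega>. ?e \<omega> \<partial>M) < \<infinity>" by order
  have "mean_overlap M \<Xi> t = enn2real (\<integral>\<^sup>+\<omega>. ?e \<omega> \<partial>M)"
    unfolding mean_overlap_def measure_def by (rule integral_enn2real(2)) (use lt in auto)
  then show "ennreal (mean_overlap M \<Xi> t) = (\<integral>\<^sup>+\<omega>. ?e \<omega> \<partial>M)" "0 \<le> mean_overlap M \<Xi> t"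
    using lt by auto
qed

lemma suminf_single_index:
  fixes c :: "'b::{comm_monoid_add,t2_space}"
  shows "(\<Sum>k. if k = j then c else 0) = c"
  using sums_unique[OF sums_single[of j "\<lambda>_. c"]] by simp

lemma random_grain_model_grain_prob:
  assumes "random_grain_model M \<Xi> N u G" "E \<in> sets fell_borel"
  shows "emeasure N (G j -` E \<inter> space N) = emeasure M (\<Xi> -` E \<inter> space M)"
proof -
  have "G j \<in> N \<rightarrow>\<^sub>M fell_borel" "\<Xi> \<in> M \<rightarrow>\<^sub>M fell_borel"
    and "distr N fell_borel (G j) = distr M fell_borel \<Xi>"
    using assms(1) by (auto simp: random_grain_model_def random_closed_set_def)
  then show ?thesis
    using assms(2) by (metis emeasure_distr)
qed

lemma sets_fell_borel_hit_point:
  fixes x :: "'a::euclidean_space"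
  shows "{F \<in> space fell_borel. x \<in> F} \<in> sets fell_borel"
  by measurable

text \<open>Conditionally on the points, two different grains are independent copies of \<open>\<Xi>\<close>, so both cover
  their point with probability \<open>p * p\<close>. The diagonal \<open>k = j\<close> concerns one grain and two points that
  differ by \<open>t\<close>, since \<open>t - u j = - u j + t\<close>.\<close>

lemma nn_integral_coverage_pair:
  fixes u :: "nat \<Rightarrow> 'v \<Rightarrow> 'a::euclidean_space" and t :: 'a
  assumes rgm: "random_grain_model M \<Xi> N u G"
  defines "p \<equiv> \<lambda>x. emeasure M {\<omega> \<in> space M. x \<in> \<Xi> \<omega>}"
    and "c \<equiv> \<lambda>x. emeasure M {\<omega> \<in> space M. x \<in> \<Xi> \<omega> \<and> x + t \<in> \<Xi> \<omega>}"
  shows "(\<integral>\<^sup>+\<omega>. indicator (G j \<omega>) (- u j \<omega>) * indicator (G k \<omega>) (t - u k \<omega>) \<partial>N)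
    = (\<integral>\<^sup>+\<omega>. (if k = j then c (- u j \<omega>) else p (- u j \<omega>) * p (t - u k \<omega>)) \<partial>N)"
    and "(\<integral>\<^sup>+\<omega>. indicator (G j \<omega>) (t - u j \<omega>) \<partial>N) = (\<integral>\<^sup>+\<omega>. p (t - u j \<omega>) \<partial>N)"
proof -
  have N: "prob_space N" and G[measurable]: "\<And>j. G j \<in> N \<rightarrow>\<^sub>M fell_borel"
    and G_indep: "prob_space.indep_vars N (\<lambda>_. fell_borel) G UNIV"
    and ind: "indep_rvs N (Pi\<^sub>M UNIV (\<lambda>_. borel)) (\<lambda>\<omega> j. u j \<omega>) (Pi\<^sub>M UNIV (\<lambda>_. fell_borel)) (\<lambda>\<omega> j. G j \<omega>)"
    and [measurable]: "\<Xi> \<in> M \<rightarrow>\<^sub>M fell_borel"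
    using rgm by (auto simp: random_grain_model_def random_closed_set_def)
  interpret prob_space N by fact
  let ?hit = "\<lambda>x. {F \<in> space fell_borel. x \<in> F}"
  have hit: "{\<omega> \<in> space N. x \<in> G j \<omega>} = G j -` ?hit x \<inter> space N" for x j
    using measurable_space[OF G] by auto
  have pN: "emeasure N {\<omega> \<in> space N. x \<in> G j \<omega>} = p x" for x j
  proof -
    have "{\<omega> \<in> space M. x \<in> \<Xi> \<omega>} = \<Xi> -` ?hit x \<inter> space M"
      using measurable_space[of \<Xi> M fell_borel] by auto
    then show ?thesis
      unfolding hit p_def by (simp only: random_grain_model_grain_prob[OF rgm sets_fell_borel_hit_point])
  qed
  have cN: "emeasure N {\<omega> \<in> space N. x \<in> G j \<omega> \<and> x + t \<in> G j \<omega>} = c x" for x j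
  proof -
    have "{\<omega> \<in> space M. x \<in> \<Xi> \<omega> \<and> x + t \<in> \<Xi> \<omega>} = \<Xi> -` (?hit x \<inter> ?hit (x + t)) \<inter> space M"
      using measurable_space[of \<Xi> M fell_borel] by auto
    moreover have "{\<omega> \<in> space N. x \<in> G j \<omega> \<and> x + t \<in> G j \<omega>} = G j -` (?hit x \<inter> ?hit (x + t)) \<inter> space N"
      using measurable_space[OF G] by auto
    ultimately show ?thesis
      unfolding c_def by (simp only: random_grain_model_grain_prob[OF rgm
          sets.Int[OF sets_fell_borel_hit_point sets_fell_borel_hit_point]])
  qed
  have ppN: "emeasure N {\<omega> \<in> space N. x \<in> G j \<omega> \<and> y \<in> G k \<omega>} = p x * p y" if "k \<noteq> j" for x y
  proof -
    define A where "A i = (if i = j then ?hit x else ?hit y)" for i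
    have "prob (\<Inter>i\<in>{j, k}. G i -` A i \<inter> space N) = (\<Prod>i\<in>{j, k}. prob (G i -` A i \<inter> space N))"
      by (rule indep_varsD[OF G_indep]) (auto simp: A_def)
    moreover have "(\<Inter>i\<in>{j, k}. G i -` A i \<inter> space N) = {\<omega> \<in> space N. x \<in> G j \<omega> \<and> y \<in> G k \<omega>}"
      using measurable_space[OF G] that by (auto simp: A_def)
    ultimately have "prob {\<omega> \<in> space N. x \<in> G j \<omega> \<and> y \<in> G k \<omega>}
        = prob {\<omega> \<in> space N. x \<in> G j \<omega>} * prob {\<omega> \<in> space N. y \<in> G k \<omega>}"
      using that by (simp add: A_def hit)
    then show ?thesis
      by (simp add: pN[of _ j, symmetric] pN[of y k, symmetric] emeasure_eq_measure ennreal_mult')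
         (metis pN emeasure_eq_measure)
  qed
  let ?\<Phi> = "\<lambda>(U, H). indicator (H j) (- U j) * indicator (H k) (t - U k) :: ennreal"
  have "(\<integral>\<^sup>+\<omega>. indicator (G j \<omega>) (- u j \<omega>) * indicator (G k \<omega>) (t - u k \<omega>) \<partial>N)
      = (\<integral>\<^sup>+\<omega>. \<integral>\<^sup>+\<omega>'. indicator (G j \<omega>') (- u j \<omega>) * indicator (G k \<omega>') (t - u k \<omega>) \<partial>N \<partial>N)"
    using indep_rvs_nn_integral[OF N ind, of ?\<Phi>] by simp
  also have "\<dots> = (\<integral>\<^sup>+\<omega>. (if k = j then c (- u j \<omega>) else p (- u j \<omega>) * p (t - u k \<omega>)) \<partial>N)"
  proof (rule nn_integral_cong)
    fix \<omega>
    have "(\<integral>\<^sup>+\<omega>'. indicator (G j \<omega>') (- u j \<omega>) * indicator (G k \<omega>') (t - u k \<omega>) \<partial>N)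
        = (\<integral>\<^sup>+\<omega>'. indicator {\<omega>' \<in> space N. - u j \<omega> \<in> G j \<omega>' \<and> t - u k \<omega> \<in> G k \<omega>'} \<omega>' \<partial>N)"
      by (intro nn_integral_cong) (simp add: indicator_def)
    also have "\<dots> = emeasure N {\<omega>' \<in> space N. - u j \<omega> \<in> G j \<omega>' \<and> t - u k \<omega> \<in> G k \<omega>'}"
      by (rule nn_integral_indicator) measurable
    also have "\<dots> = (if k = j then c (- u j \<omega>) else p (- u j \<omega>) * p (t - u k \<omega>))"
      using cN[of "- u j \<omega>" j] by (auto simp: ppN)
    finally show "(\<integral>\<^sup>+\<omega>'. indicator (G j \<omega>') (- u j \<omega>) * indicator (G k \<omega>') (t - u k \<omega>) \<partial>N)
        = (if k = j then c (- u j \<omega>) else p (- u j \<omega>) * p (t - u k \<omega>))" .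
  qed
  finally show "(\<integral>\<^sup>+\<omega>. indicator (G j \<omega>) (- u j \<omega>) * indicator (G k \<omega>) (t - u k \<omega>) \<partial>N)
      = (\<integral>\<^sup>+\<omega>. (if k = j then c (- u j \<omega>) else p (- u j \<omega>) * p (t - u k \<omega>)) \<partial>N)" .
  let ?\<Psi> = "\<lambda>(U, H). indicator (H j) (t - U j) :: ennreal"
  have "(\<integral>\<^sup>+\<omega>. indicator (G j \<omega>) (t - u j \<omega>) \<partial>N)
      = (\<integral>\<^sup>+\<omega>. \<integral>\<^sup>+\<omega>'. indicator (G j \<omega>') (t - u j \<omega>) \<partial>N \<partial>N)"
    using indep_rvs_nn_integral[OF N ind, of ?\<Psi>] by simp
  also have "\<dots> = (\<integral>\<^sup>+\<omega>. p (t - u j \<omega>) \<partial>N)"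
  proof (rule nn_integral_cong)
    fix \<omega>
    have "(\<integral>\<^sup>+\<omega>'. indicator (G j \<omega>') (t - u j \<omega>) \<partial>N)
        = (\<integral>\<^sup>+\<omega>'. indicator {\<omega>' \<in> space N. t - u j \<omega> \<in> G j \<omega>'} \<omega>' \<partial>N)"
      by (intro nn_integral_cong) (simp add: indicator_def)
    also have "\<dots> = emeasure N {\<omega>' \<in> space N. t - u j \<omega> \<in> G j \<omega>'}"
      by (rule nn_integral_indicator) measurable
    finally show "(\<integral>\<^sup>+\<omega>'. indicator (G j \<omega>') (t - u j \<omega>) \<partial>N) = p (t - u j \<omega>)"
      by (simp add: pN)
  qed
  finally show "(\<integral>\<^sup>+\<omega>. indicator (G j \<omega>) (t - u j \<omega>) \<partial>N) = (\<integral>\<^sup>+\<omega>. p (t - u j \<omega>) \<partial>N)" .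
qed

text \<open>The field with values in \<open>[0, \<infinity>]\<close>, for which the sum over the grains always makes sense.\<close>

definition coverage_count ::
  "(nat \<Rightarrow> 'v \<Rightarrow> 'a::euclidean_space) \<Rightarrow> (nat \<Rightarrow> 'v \<Rightarrow> 'a set) \<Rightarrow> 'a \<Rightarrow> 'v \<Rightarrow> ennreal"
  where "coverage_count u G t \<omega> = (\<Sum>j. indicator (G j \<omega>) (t - u j \<omega>))"

text \<open>Subtracting the diagonal of the Poisson product moment is avoided by adding it to the other side:
  \<open>a\<close> below is the true moment and \<open>b\<close> the one with independent grains throughout, and their diagonals
  are \<open>e\<close> and \<open>d\<close>. The finite total of \<open>d\<close> is cancelled at the end.\<close>

lemma coverage_count_moments:
  fixes u :: "nat \<Rightarrow> 'v \<Rightarrow> 'a::euclidean_space"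
  assumes rgm: "random_grain_model M \<Xi> N u G"
  defines "m \<equiv> \<integral>\<^sup>+\<omega>. emeasure lborel (\<Xi> \<omega>) \<partial>M"
  shows "(\<integral>\<^sup>+\<omega>. coverage_count u G t \<omega> \<partial>N) = m"
    and "(\<integral>\<^sup>+\<omega>. coverage_count u G 0 \<omega> * coverage_count u G t \<omega> \<partial>N)
      = m\<^sup>2 + (\<integral>\<^sup>+\<omega>. emeasure lborel (\<Xi> \<omega> \<inter> (\<lambda>x. x - t) ` \<Xi> \<omega>) \<partial>M)"
proof -
  have \<Xi>: "random_closed_set M \<Xi>" and fin: "m < \<infinity>" and P: "unit_poisson_process N u"
    and [measurable]: "\<And>j. G j \<in> N \<rightarrow>\<^sub>M fell_borel" "\<Xi> \<in> M \<rightarrow>\<^sub>M fell_borel" "\<And>j. u j \<in> borel_measurable N"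
    using rgm by (auto simp: random_grain_model_def random_closed_set_def unit_poisson_process_def m_def)
  interpret M: prob_space M using \<Xi> by (simp add: random_closed_set_def)
  define p where "p x = emeasure M {\<omega> \<in> space M. x \<in> \<Xi> \<omega>}" for x
  define c where "c x = emeasure M {\<omega> \<in> space M. x \<in> \<Xi> \<omega> \<and> x + t \<in> \<Xi> \<omega>}" for x
  have [measurable]: "p \<in> borel_measurable borel" "c \<in> borel_measurable borel"
    unfolding p_def c_def by measurable
  have int_p: "(\<integral>\<^sup>+x. p x \<partial>lborel) = m"
    using nn_integral_overlap_probability[OF \<Xi>, of 0] by (simp add: p_def m_def)
  have int_p': "(\<integral>\<^sup>+x. p (s - x) \<partial>lborel) = m" for s
    by (simp add: nn_integral_lborel_translate_reflect int_p)
  show mean: "(\<integral>\<^sup>+\<omega>. coverage_count u G t \<omega> \<partial>N) = m" for t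
    using nn_integral_poisson_sum[OF P, of "\<lambda>x. p (t - x)"]
    by (simp add: coverage_count_def nn_integral_suminf nn_integral_coverage_pair(2)[OF rgm] p_def[symmetric] int_p')
  have le_1: "p x \<le> 1" for x
    using M.emeasure_space_1 emeasure_space[of M] by (simp add: p_def)
  define d where "d j = (\<integral>\<^sup>+\<omega>. p (- u j \<omega>) * p (t - u j \<omega>) \<partial>N)" for j
  define e where "e j = (\<integral>\<^sup>+\<omega>. c (- u j \<omega>) \<partial>N)" for j
  define a where "a j k = (\<integral>\<^sup>+\<omega>. indicator (G j \<omega>) (- u j \<omega>) * indicator (G k \<omega>) (t - u k \<omega>) \<partial>N :: ennreal)" for j k
  define b where "b j k = (\<integral>\<^sup>+\<omega>. p (- u j \<omega>) * p (t - u k \<omega>) \<partial>N)" for j k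
  have "a j k + (if k = j then d j else 0) = b j k + (if k = j then e j else 0)" for j k
    unfolding a_def nn_integral_coverage_pair(1)[OF rgm] p_def[symmetric] c_def[symmetric]
    by (auto simp: b_def d_def e_def add.commute)
  then have "(\<Sum>j. \<Sum>k. a j k + (if k = j then d j else 0)) = (\<Sum>j. \<Sum>k. b j k + (if k = j then e j else 0))"
    by simp
  then have eq: "(\<Sum>j. \<Sum>k. a j k) + (\<Sum>j. d j) = (\<Sum>j. \<Sum>k. b j k) + (\<Sum>j. e j)"
    by (simp add: suminf_add[symmetric] suminf_single_index)
  have "(\<Sum>j. \<Sum>k. a j k) = (\<integral>\<^sup>+\<omega>. coverage_count u G 0 \<omega> * coverage_count u G t \<omega> \<partial>N)"
    by (simp add: a_def coverage_count_def nn_integral_suminf[symmetric])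
  moreover have "(\<Sum>j. \<Sum>k. b j k) = m * m + (\<integral>\<^sup>+x. p (- x) * p (t - x) \<partial>lborel)"
    using nn_integral_poisson_sum_mult[OF P, of "\<lambda>x. p (- x)" "\<lambda>x. p (t - x)"] fin int_p' int_p'[of 0]
    by (simp add: b_def nn_integral_suminf[symmetric])
  moreover have "(\<Sum>j. d j) = (\<integral>\<^sup>+x. p (- x) * p (t - x) \<partial>lborel)"
    using nn_integral_poisson_sum[OF P, of "\<lambda>x. p (- x) * p (t - x)"]
    by (simp add: d_def nn_integral_suminf)
  moreover have "(\<Sum>j. e j) = (\<integral>\<^sup>+\<omega>. emeasure lborel (\<Xi> \<omega> \<inter> (\<lambda>x. x - t) ` \<Xi> \<omega>) \<partial>M)"
    using nn_integral_poisson_sum[OF P, of "\<lambda>x. c (- x)"] nn_integral_overlap_probability[OF \<Xi>, of t]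
      nn_integral_lborel_translate_reflect[of c 0]
    by (simp add: e_def nn_integral_suminf c_def)
  ultimately have "(\<integral>\<^sup>+x. p (- x) * p (t - x) \<partial>lborel) + (\<integral>\<^sup>+\<omega>. coverage_count u G 0 \<omega> * coverage_count u G t \<omega> \<partial>N)
      = (\<integral>\<^sup>+x. p (- x) * p (t - x) \<partial>lborel)
        + (m\<^sup>2 + (\<integral>\<^sup>+\<omega>. emeasure lborel (\<Xi> \<omega> \<inter> (\<lambda>x. x - t) ` \<Xi> \<omega>) \<partial>M))"
    using eq by (simp only: power2_eq_square ac_simps)
  moreover have "(\<integral>\<^sup>+x. p (- x) * p (t - x) \<partial>lborel) \<noteq> \<top>"
  proof -
    have "(\<integral>\<^sup>+x. p (- x) * p (t - x) \<partial>lborel) \<le> (\<integral>\<^sup>+x. 1 * p (t - x) \<partial>lborel)"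
      by (intro nn_integral_mono mult_right_mono le_1) auto
    also have "\<dots> < \<top>" using fin int_p' by simp
    finally show ?thesis by simp
  qed
  ultimately show "(\<integral>\<^sup>+\<omega>. coverage_count u G 0 \<omega> * coverage_count u G t \<omega> \<partial>N)
      = m\<^sup>2 + (\<integral>\<^sup>+\<omega>. emeasure lborel (\<Xi> \<omega> \<inter> (\<lambda>x. x - t) ` \<Xi> \<omega>) \<partial>M)"
    by (simp add: ennreal_add_left_cancel)
qed

lemma grain_field_eq_coverage_count:
  assumes "coverage_count u G t \<omega> \<noteq> \<infinity>"
  shows "grain_field u G t \<omega> = enn2real (coverage_count u G t \<omega>)"
proof -
  let ?i = "\<lambda>j. indicator (G j \<omega>) (t - u j \<omega>) :: real"
  have *: "coverage_count u G t \<omega> = (\<Sum>j. ennreal (?i j))"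
    by (simp add: coverage_count_def ennreal_indicator)
  then have "summable ?i"
    using assms by (intro summable_suminf_not_top) auto
  then have "coverage_count u G t \<omega> = ennreal (\<Sum>j. ?i j)"
    unfolding * by (intro suminf_ennreal2) auto
  moreover have "t \<in> (\<lambda>x. u j \<omega> + x) ` G j \<omega> \<longleftrightarrow> t - u j \<omega> \<in> G j \<omega>" for j
    by (auto simp: image_iff intro: bexI[of _ "t - u j \<omega>"])
  then have "grain_field u G t \<omega> = (\<Sum>j. ?i j)"
    by (simp add: grain_field_def indicator_def)
  ultimately show ?thesis
    using \<open>summable ?i\<close> by (simp add: suminf_nonneg)
qed

lemma random_grain_model_covariance:
  fixes u :: "nat \<Rightarrow> 'v \<Rightarrow> 'a::euclidean_space"
  assumes rgm: "random_grain_model M \<Xi> N u G"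
  shows "covar N (grain_field u G 0) (grain_field u G t) = mean_overlap M \<Xi> t"
proof -
  let ?m = "\<integral>\<^sup>+\<omega>. emeasure lborel (\<Xi> \<omega>) \<partial>M"
  have \<Xi>: "random_closed_set M \<Xi>" and fin: "?m < \<infinity>" and "prob_space N"
    and [measurable]: "\<And>j. G j \<in> N \<rightarrow>\<^sub>M fell_borel" "\<And>j. u j \<in> borel_measurable N"
    using rgm by (auto simp: random_grain_model_def random_closed_set_def unit_poisson_process_def)
  interpret N: prob_space N by fact
  let ?C = "coverage_count u G" and ?X = "\<lambda>s \<omega>. enn2real (coverage_count u G s \<omega>)"
  have C[measurable]: "?C s \<in> borel_measurable N" for s
    unfolding coverage_count_def by measurable
  have "AE \<omega> in N. ?C s \<omega> \<noteq> \<infinity>" for s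
    by (rule nn_integral_PInf_AE) (use fin coverage_count_moments(1)[OF rgm] in auto)
  then have AE: "AE \<omega> in N. grain_field u G s \<omega> = ?X s \<omega>" for s
    by eventually_elim (rule grain_field_eq_coverage_count)
  have [measurable]: "grain_field u G s \<in> borel_measurable N" for s
  proof -
    have "x \<in> (\<lambda>y. v + y) ` F \<longleftrightarrow> x - v \<in> F" for x v :: 'a and F
      by (auto simp: image_iff intro: bexI[of _ "x - v"])
    then have "grain_field u G s = (\<lambda>\<omega>. \<Sum>j. indicator (G j \<omega>) (s - u j \<omega>))"
      by (simp add: grain_field_def[abs_def] indicator_def)
    then show ?thesis by simp
  qed
  have X: "integrable N (?X s)" "(\<integral>\<omega>. ?X s \<omega> \<partial>N) = enn2real ?m" for s
    using integral_enn2real[of "?C s" N] fin coverage_count_moments(1)[OF rgm, of s] by auto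
  note overlap = ennreal_mean_overlap[OF \<Xi> fin, of t]
  have mom2: "(\<integral>\<^sup>+\<omega>. ?C 0 \<omega> * ?C t \<omega> \<partial>N) = ?m\<^sup>2 + ennreal (mean_overlap M \<Xi> t)"
    by (simp add: coverage_count_moments(2)[OF rgm] overlap)
  then have "(\<integral>\<^sup>+\<omega>. ?C 0 \<omega> * ?C t \<omega> \<partial>N) < \<infinity>"
    using fin by (simp add: power2_eq_square ennreal_mult_less_top)
  note integral_enn2real[OF _ this]
  then have XX: "integrable N (\<lambda>\<omega>. ?X 0 \<omega> * ?X t \<omega>)"
      "(\<integral>\<omega>. ?X 0 \<omega> * ?X t \<omega> \<partial>N) = (enn2real ?m)\<^sup>2 + mean_overlap M \<Xi> t"
    using fin overlap(3) by (simp_all add: mom2 enn2real_mult enn2real_plus power2_eq_square ennreal_mult_less_top)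
  have "covar N (grain_field u G 0) (grain_field u G t)
      = (\<integral>\<omega>. (?X 0 \<omega> - enn2real ?m) * (?X t \<omega> - enn2real ?m) \<partial>N)"
  proof -
    have "(\<integral>\<omega>. grain_field u G s \<omega> \<partial>N) = enn2real ?m" for s
      unfolding X(2)[of s, symmetric] by (rule integral_cong_AE) (use AE in auto)
    then show ?thesis
      unfolding covar_def by (intro integral_cong_AE) (use AE[of 0] AE[of t] in auto)
  qed
  also have "\<dots> = (\<integral>\<omega>. ?X 0 \<omega> * ?X t \<omega> - enn2real ?m * ?X 0 \<omega> - enn2real ?m * ?X t \<omega> + (enn2real ?m)\<^sup>2 \<partial>N)"
    by (simp add: algebra_simps power2_eq_square)
  also have "\<dots> = mean_overlap M \<Xi> t"
    using X XX by (simp add: N.prob_space power2_eq_square)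
  finally show ?thesis .
qed

section \<open>Tails of a positive random variable\<close>

lemma asymp_equiv_powr_iff:
  fixes f :: "real \<Rightarrow> real"
  assumes "c \<noteq> 0"
  shows "f \<sim>[at_top] (\<lambda>x. c * x powr (- a)) \<longleftrightarrow> ((\<lambda>x. x powr a * f x) \<longlongrightarrow> c) at_top"
proof -
  have "f \<sim>[at_top] (\<lambda>x. c * x powr (- a)) \<longleftrightarrow> ((\<lambda>x. x powr a * f x / c) \<longlongrightarrow> 1) at_top"
    unfolding asymp_equiv_def
  proof (intro tendsto_cong eventually_mono[OF eventually_gt_at_top[of 0]])
    fix x :: real assume "0 < x"
    then show "(if f x = 0 \<and> c * x powr (- a) = 0 then 1 else f x / (c * x powr (- a))) = x powr a * f x / c"
      using assms by (simp add: powr_minus divide_simps)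
  qed
  also have "\<dots> \<longleftrightarrow> ((\<lambda>x. x powr a * f x) \<longlongrightarrow> c) at_top"
  proof
    assume "((\<lambda>x. x powr a * f x / c) \<longlongrightarrow> 1) at_top"
    from tendsto_mult_right[OF this, of c] assms show "((\<lambda>x. x powr a * f x) \<longlongrightarrow> c) at_top"
      by simp
  next
    assume "((\<lambda>x. x powr a * f x) \<longlongrightarrow> c) at_top"
    from tendsto_divide[OF this tendsto_const assms] assms
    show "((\<lambda>x. x powr a * f x / c) \<longlongrightarrow> 1) at_top" by simp
  qed
  finally show ?thesis .
qed

text \<open>Beyond some \<open>x0\<close> the limit gives the bound; below \<open>x0\<close> it follows from \<open>F \<le> 1\<close>.\<close>

lemma tail_bound_of_limit:
  fixes F :: "real \<Rightarrow> real"
  assumes lim: "((\<lambda>x. x powr \<alpha> * F x) \<longlongrightarrow> c) at_top" and "0 \<le> \<alpha>" and F: "\<And>x. F x \<le> 1"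
  shows "\<exists>K>0. \<forall>x>0. x powr \<alpha> * F x \<le> K"
proof -
  have "\<forall>\<^sub>F x in at_top. x powr \<alpha> * F x < c + 1"
    by (rule order_tendstoD(2)[OF lim]) simp
  then obtain x0 where x0: "\<And>x. x0 \<le> x \<Longrightarrow> x powr \<alpha> * F x < c + 1"
    by (auto simp: eventually_at_top_linorder)
  define K where "K = max 1 (max (c + 1) (x0 powr \<alpha>))"
  have "x powr \<alpha> * F x \<le> K" if "0 < x" for x
  proof (cases "x0 \<le> x")
    case True
    with x0[of x] show ?thesis by (simp add: K_def)
  next
    case False
    have "x powr \<alpha> * F x \<le> x powr \<alpha> * 1" using F by (intro mult_left_mono) auto
    also have "\<dots> \<le> x0 powr \<alpha>" using False that \<open>0 \<le> \<alpha>\<close> by (simp add: powr_mono2)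
    finally show ?thesis by (simp add: K_def)
  qed
  then show ?thesis by (intro exI[of _ K]) (auto simp: K_def)
qed

text \<open>Layer-cake formula: the truncated mean is the integral of \<open>P(R > max s y)\<close> over \<open>s > 0\<close>. The
  interval \<open>{0..y}\<close> contributes \<open>K * y powr (1 - \<alpha>)\<close>, and \<open>{y..}\<close> contributes the same divided by
  \<open>\<alpha> - 1\<close>.\<close>

lemma truncated_mean_bound:
  fixes R :: "'w \<Rightarrow> real"
  assumes "prob_space M" and [measurable]: "R \<in> borel_measurable M"
    and "1 < \<alpha>" "0 < K" and K: "\<And>x. 0 < x \<Longrightarrow> x powr \<alpha> * measure M {\<omega> \<in> space M. x < R \<omega>} \<le> K" and "0 < y"
  shows "(\<integral>\<^sup>+\<omega>. ennreal (R \<omega>) * indicator {y<..} (R \<omega>) \<partial>M) \<le> ennreal (K * (1 + 1 / (\<alpha> - 1)) * y powr (1 - \<alpha>))"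
proof -
  interpret prob_space M by fact
  interpret pair_sigma_finite M "lborel :: real measure" ..
  have tail: "prob {\<omega> \<in> space M. x < R \<omega>} \<le> K * x powr (- \<alpha>)" if "0 < x" for x
    using K[OF that] that by (simp add: powr_minus divide_simps mult.commute)
  have layer: "ennreal r * indicator {y<..} r = (\<integral>\<^sup>+s. of_bool (0 < s \<and> s < r \<and> y < r) \<partial>lborel)" for r
  proof (cases "y < r")
    case True
    have "(\<integral>\<^sup>+s. of_bool (0 < s \<and> s < r \<and> y < r) \<partial>lborel) = (\<integral>\<^sup>+s. indicator {0<..<r} s \<partial>lborel)"
      using True by (intro nn_integral_cong) (auto simp: indicator_def)
    with True \<open>0 < y\<close> show ?thesis by simp
  qed simp
  have "(\<integral>\<^sup>+\<omega>. ennreal (R \<omega>) * indicator {y<..} (R \<omega>) \<partial>M)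
      = (\<integral>\<^sup>+s. \<integral>\<^sup>+\<omega>. of_bool (0 < s \<and> s < R \<omega> \<and> y < R \<omega>) \<partial>M \<partial>lborel)"
    unfolding layer by (rule Fubini'[symmetric]) measurable
  also have "\<dots> \<le> (\<integral>\<^sup>+s. ennreal (K * y powr (- \<alpha>)) * indicator {0..y} s
      + ennreal K * (ennreal (s powr (- \<alpha>)) * indicator {y..} s) \<partial>lborel)"
  proof (rule nn_integral_mono)
    fix s :: real
    show "(\<integral>\<^sup>+\<omega>. of_bool (0 < s \<and> s < R \<omega> \<and> y < R \<omega>) \<partial>M) \<le> ennreal (K * y powr (- \<alpha>)) * indicator {0..y} s
      + ennreal K * (ennreal (s powr (- \<alpha>)) * indicator {y..} s)"
    proof (cases "0 < s")
      case True
      then have m: "0 < max s y" by simp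
      have "(\<integral>\<^sup>+\<omega>. of_bool (0 < s \<and> s < R \<omega> \<and> y < R \<omega>) \<partial>M)
          = (\<integral>\<^sup>+\<omega>. indicator {\<omega> \<in> space M. max s y < R \<omega>} \<omega> \<partial>M)"
        using True by (intro nn_integral_cong) (simp add: indicator_def)
      also have "\<dots> = ennreal (prob {\<omega> \<in> space M. max s y < R \<omega>})"
        by (simp add: emeasure_eq_measure)
      also have "\<dots> \<le> ennreal (K * max s y powr (- \<alpha>))"
        by (intro ennreal_leI tail m)
      also have "\<dots> \<le> ennreal (K * y powr (- \<alpha>)) * indicator {0..y} s
          + ennreal K * (ennreal (s powr (- \<alpha>)) * indicator {y..} s)"
        using True \<open>0 < K\<close> by (auto simp: max_def indicator_def ennreal_mult)
      finally show ?thesis .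
    qed simp
  qed
  also have "\<dots> = ennreal (K * y powr (- \<alpha>)) * ennreal y + ennreal K * ennreal (y powr (1 - \<alpha>) / (\<alpha> - 1))"
    using assms by (simp add: nn_integral_add nn_integral_cmult nn_integral_cmult_indicator nn_integral_powr_tail)
  also have "\<dots> = ennreal (K * y powr (- \<alpha>) * y + K * (y powr (1 - \<alpha>) / (\<alpha> - 1)))"
    using assms by (simp add: ennreal_mult[symmetric] ennreal_plus[symmetric] del: ennreal_plus)
  also have "K * y powr (- \<alpha>) * y + K * (y powr (1 - \<alpha>) / (\<alpha> - 1)) = K * (1 + 1 / (\<alpha> - 1)) * y powr (1 - \<alpha>)"
  proof -
    have "y powr (- \<alpha>) * y = y powr (1 - \<alpha>)"
      using \<open>0 < y\<close> powr_add[of y "- \<alpha>" 1] by (simp add: add.commute)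
    then show ?thesis by (simp add: mult.assoc distrib_left distrib_right)
  qed
  finally show ?thesis .
qed

section \<open>Homothetic grains\<close>

text \<open>For \<open>c = 0\<close> the set on the left has at most one point, and the right-hand side vanishes even if
  \<open>S\<close> has infinite measure. Including this case makes the volume of the homothetic grain a measurable
  function of \<open>\<omega>\<close> everywhere, not just where \<open>R > 0\<close>.\<close>

lemma emeasure_lborel_scaled_overlap:
  fixes S :: "'a::euclidean_space set"
  assumes S: "S \<in> sets borel"
  shows "emeasure lborel ((\<lambda>x. c *\<^sub>R x) ` S \<inter> (\<lambda>x. x - t) ` (\<lambda>x. c *\<^sub>R x) ` S)
    = ennreal (\<bar>c\<bar> ^ DIM('a)) * emeasure lborel (S \<inter> (\<lambda>x. x - t /\<^sub>R c) ` S)"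
proof (cases "c = 0")
  case True
  let ?T = "(\<lambda>x. c *\<^sub>R x) ` S \<inter> (\<lambda>x. x - t) ` (\<lambda>x. c *\<^sub>R x) ` S"
  have "emeasure lborel ?T \<le> emeasure lborel {0 :: 'a}"
    using True by (intro emeasure_mono) auto
  with True show ?thesis by simp
next
  case False
  let ?S = "(\<lambda>x. c *\<^sub>R x) ` S"
  have mem: "x \<in> ?S \<longleftrightarrow> x /\<^sub>R c \<in> S" for x
  proof
    assume "x /\<^sub>R c \<in> S"
    moreover have "x = c *\<^sub>R (x /\<^sub>R c)" using False by simp
    ultimately show "x \<in> ?S" by (rule rev_image_eqI)
  qed (use False in auto)
  have "?S = (\<lambda>x. x /\<^sub>R c) -` S \<inter> space borel"
    by (rule set_eqI) (simp only: mem vimage_eq Int_iff space_borel UNIV_I simp_thms)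
  also have "\<dots> \<in> sets borel" by (rule measurable_sets[OF _ S]) simp
  finally have "?S \<inter> (\<lambda>x. x - t) ` ?S \<in> sets borel" by (rule sets_borel_overlap)
  then have "emeasure lborel (?S \<inter> (\<lambda>x. x - t) ` ?S)
      = ennreal (\<bar>c\<bar> ^ DIM('a)) * (\<integral>\<^sup>+x. indicator (?S \<inter> (\<lambda>x. x - t) ` ?S) (0 + c *\<^sub>R x) \<partial>lborel)"
    using False by (subst nn_integral_lborel_affine[symmetric]) auto
  also have "(\<lambda>x. indicator (?S \<inter> (\<lambda>x. x - t) ` ?S) (0 + c *\<^sub>R x))
      = (indicator (S \<inter> (\<lambda>x. x - t /\<^sub>R c) ` S) :: 'a \<Rightarrow> ennreal)"
    using False unfolding indicator_def by (simp add: mem_shift_image mem scaleR_add_right fun_eq_iff)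
  finally show ?thesis
    using S by (simp add: sets_borel_overlap)
qed

text \<open>The numbers \<open>V\<close> and \<open>\<delta>\<close> are parameters tied by equations, because a constant depending only on
  the dimension would have to carry the type of the ambient space as an argument.\<close>

locale homothetic_grain_setup =
  fixes M :: "'w measure" and R :: "'w \<Rightarrow> real" and \<Xi>0 :: "'w \<Rightarrow> 'a::euclidean_space set"
    and V \<delta> :: real
  assumes V_def: "V = measure lborel (cball 0 1 :: 'a set)"
    and delta_def: "\<delta> = 1 / real DIM('a)"
    and R_measurable [measurable]: "R \<in> borel_measurable M"
    and R_pos: "AE \<omega> in M. 0 < R \<omega>"
    and closed_set: "random_closed_set M \<Xi>0"
    and ball: "AE \<omega> in M. \<Xi>0 \<omega> \<subseteq> {t. norm t \<le> 1}"
    and indep: "indep_rvs M borel R fell_borel \<Xi>0"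
begin

sublocale prob_space M
  using closed_set by (simp add: random_closed_set_def)

lemma grain_measurable [measurable]: "\<Xi>0 \<in> M \<rightarrow>\<^sub>M fell_borel"
  using closed_set by (simp add: random_closed_set_def)

abbreviation "\<Xi> \<equiv> homothetic_grain R \<Xi>0"
abbreviation "radius r \<equiv> r powr \<delta>"

lemma V_nonneg [simp]: "0 \<le> V"
  by (simp add: V_def)

lemma radius_power: "0 < r \<Longrightarrow> radius r ^ DIM('a) = r"
  by (simp add: delta_def powr_realpow[symmetric] powr_powr)

lemma emeasure_ball: "emeasure lborel (cball 0 1 :: 'a set) = ennreal V"
  using emeasure_lborel_cball_finite[of "0::'a" 1] by (simp add: V_def emeasure_eq_ennreal_measure less_top)

lemma emeasure_unit_grain_le: "AE \<omega> in M. emeasure lborel (\<Xi>0 \<omega>) \<le> ennreal V"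
  using ball by eventually_elim (auto simp: emeasure_ball[symmetric] dist_norm intro!: emeasure_mono)

lemma unit_grain_mean_finite: "(\<integral>\<^sup>+\<omega>. emeasure lborel (\<Xi>0 \<omega>) \<partial>M) < \<infinity>"
proof -
  have "(\<integral>\<^sup>+\<omega>. emeasure lborel (\<Xi>0 \<omega>) \<partial>M) \<le> (\<integral>\<^sup>+\<omega>. ennreal V \<partial>M)"
    by (rule nn_integral_mono_AE[OF emeasure_unit_grain_le])
  then show ?thesis by (simp add: emeasure_space_1 order.strict_trans1)
qed

lemmas unit_overlap = ennreal_mean_overlap[OF closed_set unit_grain_mean_finite]

lemma unit_overlap_le: "mean_overlap M \<Xi>0 s \<le> V"
proof -
  have "ennreal (mean_overlap M \<Xi>0 s) \<le> (\<integral>\<^sup>+\<omega>. ennreal V \<partial>M)"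
    unfolding unit_overlap(1)
  proof (rule nn_integral_mono_AE)
    show "AE \<omega> in M. emeasure lborel (\<Xi>0 \<omega> \<inter> (\<lambda>x. x - s) ` \<Xi>0 \<omega>) \<le> ennreal V"
      using emeasure_unit_grain_le AE_space
    proof eventually_elim
      case (elim \<omega>)
      have "emeasure lborel (\<Xi>0 \<omega> \<inter> (\<lambda>x. x - s) ` \<Xi>0 \<omega>) \<le> emeasure lborel (\<Xi>0 \<omega>)"
        using random_closed_set_borel[OF closed_set elim(2)] by (intro emeasure_mono) auto
      with elim(1) show ?case by order
    qed
  qed
  then show ?thesis by (simp add: emeasure_space_1)
qed

text \<open>Two points of the unit ball have distance at most \<open>2\<close>.\<close>

lemma unit_overlap_eq_0:
  assumes "2 < norm s"
  shows "mean_overlap M \<Xi>0 s = 0"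
proof -
  have "AE \<omega> in M. emeasure lborel (\<Xi>0 \<omega> \<inter> (\<lambda>x. x - s) ` \<Xi>0 \<omega>) = 0"
    using ball
  proof eventually_elim
    case (elim \<omega>)
    have False if "x \<in> \<Xi>0 \<omega>" "x + s \<in> \<Xi>0 \<omega>" for x
    proof -
      have "norm x \<le> 1" "norm (x + s) \<le> 1" using elim that by auto
      then show False using assms norm_triangle_ineq4[of "x + s" x] by simp
    qed
    then have "\<Xi>0 \<omega> \<inter> (\<lambda>x. x - s) ` \<Xi>0 \<omega> = {}"
      by (auto simp: mem_shift_image) (use mem_shift_image in blast)
    then show ?case by simp
  qed
  then have "(\<integral>\<^sup>+\<omega>. emeasure lborel (\<Xi>0 \<omega> \<inter> (\<lambda>x. x - s) ` \<Xi>0 \<omega>) \<partial>M) = 0"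
    by (simp add: nn_integral_0_iff_AE)
  then show ?thesis
    using unit_overlap(1,3)[of s] by simp
qed

lemma unit_overlap_measurable [measurable]: "mean_overlap M \<Xi>0 \<in> borel_measurable borel"
proof -
  have "mean_overlap M \<Xi>0 = (\<lambda>s. enn2real (\<integral>\<^sup>+\<omega>. emeasure lborel (\<Xi>0 \<omega> \<inter> (\<lambda>x. x - s) ` \<Xi>0 \<omega>) \<partial>M))"
    using unit_overlap(1,3) by (metis enn2real_ennreal)
  also have "\<dots> \<in> borel_measurable borel" by measurable
  finally show ?thesis .
qed

lemma emeasure_grain_overlap:
  assumes "\<omega> \<in> space M"
  shows "emeasure lborel (\<Xi> \<omega> \<inter> (\<lambda>x. x - t) ` \<Xi> \<omega>)
    = ennreal (radius (R \<omega>) ^ DIM('a)) * emeasure lborel (\<Xi>0 \<omega> \<inter> (\<lambda>x. x - t /\<^sub>R radius (R \<omega>)) ` \<Xi>0 \<omega>)"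
  unfolding homothetic_grain_def delta_def
  by (subst emeasure_lborel_scaled_overlap[OF random_closed_set_borel[OF closed_set assms]]) simp

lemma emeasure_grain:
  assumes "\<omega> \<in> space M"
  shows "emeasure lborel (\<Xi> \<omega>) = ennreal (radius (R \<omega>) ^ DIM('a)) * emeasure lborel (\<Xi>0 \<omega>)"
  using emeasure_grain_overlap[OF assms, of 0] by simp

lemma AE_emeasure_grain: "AE \<omega> in M. emeasure lborel (\<Xi> \<omega>) = ennreal (R \<omega>) * emeasure lborel (\<Xi>0 \<omega>)"
  using R_pos AE_space by eventually_elim (simp add: emeasure_grain radius_power)

lemma AE_emeasure_grain_le: "AE \<omega> in M. emeasure lborel (\<Xi> \<omega>) \<le> ennreal V * ennreal (R \<omega>)"
  using AE_emeasure_grain emeasure_unit_grain_le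
  by eventually_elim (simp add: mult.commute[of "ennreal V"] mult_left_mono)

lemma measurable_emeasure_grain_overlap [measurable]:
  "(\<lambda>\<omega>. emeasure lborel (\<Xi> \<omega> \<inter> (\<lambda>x. x - t) ` \<Xi> \<omega>)) \<in> borel_measurable M"
  by (subst measurable_cong[OF emeasure_grain_overlap], assumption) measurable

lemma measurable_emeasure_grain [measurable]: "(\<lambda>\<omega>. emeasure lborel (\<Xi> \<omega>)) \<in> borel_measurable M"
  by (subst measurable_cong[OF emeasure_grain], assumption) measurable

text \<open>The scaling identity that governs the covariance: integrate out the shape of the grain for a fixed
  radius.\<close>

lemma nn_integral_grain_overlap:
  "(\<integral>\<^sup>+\<omega>. emeasure lborel (\<Xi> \<omega> \<inter> (\<lambda>x. x - t) ` \<Xi> \<omega>) \<partial>M)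
    = (\<integral>\<^sup>+\<omega>. ennreal (R \<omega>) * ennreal (mean_overlap M \<Xi>0 (t /\<^sub>R radius (R \<omega>))) \<partial>M)"
proof -
  let ?\<Phi> = "\<lambda>(r, F). ennreal r * emeasure lborel (F \<inter> (\<lambda>x. x - t /\<^sub>R radius r) ` F)"
  have "(\<integral>\<^sup>+\<omega>. emeasure lborel (\<Xi> \<omega> \<inter> (\<lambda>x. x - t) ` \<Xi> \<omega>) \<partial>M) = (\<integral>\<^sup>+\<omega>. ?\<Phi> (R \<omega>, \<Xi>0 \<omega>) \<partial>M)"
    using R_pos AE_space
    by (intro nn_integral_cong_AE, eventually_elim)
      (simp add: emeasure_grain_overlap radius_power)
  also have "\<dots> = (\<integral>\<^sup>+\<omega>. \<integral>\<^sup>+\<omega>'. ?\<Phi> (R \<omega>, \<Xi>0 \<omega>') \<partial>M \<partial>M)"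
    by (rule indep_rvs_nn_integral[OF prob_space_axioms indep]) measurable
  also have "\<dots> = (\<integral>\<^sup>+\<omega>. ennreal (R \<omega>) * ennreal (mean_overlap M \<Xi>0 (t /\<^sub>R radius (R \<omega>))) \<partial>M)"
    by (simp add: nn_integral_cmult unit_overlap(1))
  finally show ?thesis .
qed

lemma grain_mean_finite:
  assumes "(\<integral>\<^sup>+\<omega>. ennreal (R \<omega>) \<partial>M) < \<infinity>"
  shows "(\<integral>\<^sup>+\<omega>. emeasure lborel (\<Xi> \<omega>) \<partial>M) < \<infinity>"
proof -
  have "(\<integral>\<^sup>+\<omega>. emeasure lborel (\<Xi> \<omega>) \<partial>M) \<le> (\<integral>\<^sup>+\<omega>. ennreal V * ennreal (R \<omega>) \<partial>M)"
    by (rule nn_integral_mono_AE[OF AE_emeasure_grain_le])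
  also have "\<dots> < \<infinity>"
    using assms by (simp add: nn_integral_cmult ennreal_mult_less_top)
  finally show ?thesis .
qed

lemma ennreal_mean_overlap_grain:
  assumes "(\<integral>\<^sup>+\<omega>. ennreal (R \<omega>) \<partial>M) < \<infinity>"
  shows "ennreal (mean_overlap M \<Xi> t)
      = (\<integral>\<^sup>+\<omega>. ennreal (R \<omega>) * ennreal (mean_overlap M \<Xi>0 (t /\<^sub>R radius (R \<omega>))) \<partial>M)"
    and "0 \<le> mean_overlap M \<Xi> t"
proof -
  let ?e = "\<lambda>\<omega>. emeasure lborel (\<Xi> \<omega> \<inter> (\<lambda>x. x - t) ` \<Xi> \<omega>)"
  have "(\<integral>\<^sup>+\<omega>. ?e \<omega> \<partial>M) \<le> (\<integral>\<^sup>+\<omega>. ennreal V * ennreal (R \<omega>) \<partial>M)"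
    unfolding nn_integral_grain_overlap mult.commute[of "ennreal V"]
    by (intro nn_integral_mono mult_left_mono ennreal_leI unit_overlap_le) auto
  also have "\<dots> < \<infinity>"
    using assms by (simp add: nn_integral_cmult ennreal_mult_less_top)
  finally have fin: "(\<integral>\<^sup>+\<omega>. ?e \<omega> \<partial>M) < \<infinity>" .
  have "mean_overlap M \<Xi> t = enn2real (\<integral>\<^sup>+\<omega>. ?e \<omega> \<partial>M)"
    unfolding mean_overlap_def measure_def by (rule integral_enn2real(2)) (use fin in auto)
  with fin show "ennreal (mean_overlap M \<Xi> t)
      = (\<integral>\<^sup>+\<omega>. ennreal (R \<omega>) * ennreal (mean_overlap M \<Xi>0 (t /\<^sub>R radius (R \<omega>))) \<partial>M)"
    "0 \<le> mean_overlap M \<Xi> t"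
    by (simp_all add: nn_integral_grain_overlap)
qed

lemma less_radius_iff:
  assumes "0 < r" "0 \<le> l"
  shows "l < radius r \<longleftrightarrow> l ^ DIM('a) < r"
proof -
  have "l < radius r \<longleftrightarrow> l ^ DIM('a) < radius r ^ DIM('a)"
    using assms power_strict_mono[of l "radius r" "DIM('a)"] power_less_imp_less_base[of l "DIM('a)" "radius r"] by auto
  then show ?thesis using radius_power[OF assms(1)] by simp
qed

lemma grain_borel: "\<omega> \<in> space M \<Longrightarrow> \<Xi> \<omega> \<in> sets borel"
  using random_closed_set_closed[OF closed_set] by (simp add: homothetic_grain_def closed_scaling)

abbreviation "unit_volume \<omega> \<equiv> measure lborel (\<Xi>0 \<omega>)"

lemma unit_volume_measurable [measurable]: "unit_volume \<in> borel_measurable M"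
  unfolding measure_def by measurable

lemma unit_volume_le: "AE \<omega> in M. unit_volume \<omega> \<le> V"
  using emeasure_unit_grain_le by eventually_elim (simp add: measure_def enn2real_leI)

lemma AE_measure_grain: "AE \<omega> in M. measure lborel (\<Xi> \<omega>) = R \<omega> * unit_volume \<omega>"
  using AE_emeasure_grain R_pos by eventually_elim (simp add: measure_def enn2real_mult)

text \<open>A set of diameter less than \<open>norm t\<close> is disjoint from its translate by \<open>t\<close>. For these \<open>r\<close> the
  scaled unit ball has diameter at most \<open>norm t / 2\<close>; the spare factor \<open>2\<close> allows the boundary case
  \<open>r = (norm t / 4) ^ DIM('a)\<close>, so that the radii that matter satisfy a strict inequality.\<close>

lemma rescaled_overlap_eq_0:
  assumes "0 < r" "r \<le> (norm t / 4) ^ DIM('a)"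
  shows "mean_overlap M \<Xi>0 (t /\<^sub>R radius r) = 0"
proof (rule unit_overlap_eq_0)
  have r: "0 < radius r" using assms(1) by simp
  have "radius r \<le> norm t / 4"
    using less_radius_iff[OF assms(1), of "norm t / 4"] assms(2) by simp
  with r have "2 * radius r < norm t" by linarith
  with r show "2 < norm (t /\<^sub>R radius r)"
    by (simp add: field_simps)
qed

lemma R_mean_le_truncated:
  assumes "0 \<le> y"
  shows "(\<integral>\<^sup>+\<omega>. ennreal (R \<omega>) \<partial>M) \<le> ennreal y + (\<integral>\<^sup>+\<omega>. ennreal (R \<omega>) * indicator {y<..} (R \<omega>) \<partial>M)"
proof -
  have "(\<integral>\<^sup>+\<omega>. ennreal (R \<omega>) \<partial>M) \<le> (\<integral>\<^sup>+\<omega>. ennreal y + ennreal (R \<omega>) * indicator {y<..} (R \<omega>) \<partial>M)"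
    by (intro nn_integral_mono) (auto simp: indicator_def intro!: ennreal_leI)
  then show ?thesis
    by (simp add: nn_integral_add emeasure_space_1)
qed

text \<open>Grains of scale at most \<open>norm t / 4\<close> contribute nothing, and every other grain contributes at most
  its full volume.\<close>

lemma mean_overlap_le_truncated:
  assumes "(\<integral>\<^sup>+\<omega>. ennreal (R \<omega>) \<partial>M) < \<infinity>"
  shows "ennreal (mean_overlap M \<Xi> t)
    \<le> ennreal V * (\<integral>\<^sup>+\<omega>. ennreal (R \<omega>) * indicator {(norm t / 4) ^ DIM('a)<..} (R \<omega>) \<partial>M)"
proof -
  let ?y = "(norm t / 4) ^ DIM('a)"
  have "ennreal (mean_overlap M \<Xi> t) \<le> (\<integral>\<^sup>+\<omega>. ennreal V * (ennreal (R \<omega>) * indicator {?y<..} (R \<omega>)) \<partial>M)"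
    unfolding ennreal_mean_overlap_grain(1)[OF assms]
  proof (rule nn_integral_mono_AE)
    show "AE \<omega> in M. ennreal (R \<omega>) * ennreal (mean_overlap M \<Xi>0 (t /\<^sub>R radius (R \<omega>)))
        \<le> ennreal V * (ennreal (R \<omega>) * indicator {?y<..} (R \<omega>))"
      using R_pos
    proof eventually_elim
      case (elim \<omega>)
      show ?case
      proof (cases "?y < R \<omega>")
        case True
        then show ?thesis
          by (simp add: mult.commute[of "ennreal V"] mult_left_mono ennreal_leI unit_overlap_le)
      next
        case False
        with elim show ?thesis by (simp add: rescaled_overlap_eq_0)
      qed
    qed
  qed
  then show ?thesis by (simp add: nn_integral_cmult)
qed

lemma AE_volume_outside_le:
  assumes "0 \<le> l"
  shows "AE \<omega> in M. ennreal (measure lborel (\<Xi> \<omega> \<inter> {t. l < norm t}))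
      \<le> ennreal V * (ennreal (R \<omega>) * indicator {l ^ DIM('a)<..} (R \<omega>))"
  using R_pos AE_emeasure_grain_le AE_space ball
proof eventually_elim
  case (elim \<omega>)
  show ?case
  proof (cases "l ^ DIM('a) < R \<omega>")
    case True
    have "ennreal (measure lborel (\<Xi> \<omega> \<inter> {t. l < norm t})) \<le> emeasure lborel (\<Xi> \<omega> \<inter> {t. l < norm t})"
      by (cases "emeasure lborel (\<Xi> \<omega> \<inter> {t. l < norm t})") (auto simp: measure_def)
    also have "\<dots> \<le> emeasure lborel (\<Xi> \<omega>)"
      using grain_borel[OF elim(3)] by (intro emeasure_mono) auto
    also note elim(2)
    finally show ?thesis using True by simp
  next
    case False
    with less_radius_iff[OF elim(1) assms] have rad: "radius (R \<omega>) \<le> l" by simp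
    have "norm (radius (R \<omega>) *\<^sub>R x) \<le> l" if "x \<in> \<Xi>0 \<omega>" for x
    proof -
      have "norm x \<le> 1" using elim(4) that by auto
      then have "norm (radius (R \<omega>) *\<^sub>R x) \<le> radius (R \<omega>)"
        by (simp add: mult_left_le)
      with rad show ?thesis by simp
    qed
    then have "\<Xi> \<omega> \<inter> {t. l < norm t} = {}"
      by (force simp: homothetic_grain_def delta_def)
    then show ?thesis by simp
  qed
qed

lemma grain_second_moment_finite:
  assumes "(\<integral>\<^sup>+\<omega>. ennreal ((R \<omega>)\<^sup>2) \<partial>M) < \<infinity>"
  shows "(\<integral>\<^sup>+\<omega>. (emeasure lborel (\<Xi> \<omega>))\<^sup>2 \<partial>M) < \<infinity>"
proof -
  have "(\<integral>\<^sup>+\<omega>. (emeasure lborel (\<Xi> \<omega>))\<^sup>2 \<partial>M) \<le> (\<integral>\<^sup>+\<omega>. ennreal (V\<^sup>2) * ennreal ((R \<omega>)\<^sup>2) \<partial>M)"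
  proof (rule nn_integral_mono_AE)
    show "AE \<omega> in M. (emeasure lborel (\<Xi> \<omega>))\<^sup>2 \<le> ennreal (V\<^sup>2) * ennreal ((R \<omega>)\<^sup>2)"
      using AE_emeasure_grain_le R_pos
    proof eventually_elim
      case (elim \<omega>)
      then have "(emeasure lborel (\<Xi> \<omega>))\<^sup>2 \<le> (ennreal V * ennreal (R \<omega>))\<^sup>2"
        by (intro power_mono) auto
      also have "\<dots> = ennreal (V\<^sup>2) * ennreal ((R \<omega>)\<^sup>2)"
        using elim(2) by (simp add: power_mult_distrib ennreal_power)
      finally show ?case .
    qed
  qed
  also have "\<dots> < \<infinity>"
    using assms by (simp add: nn_integral_cmult ennreal_mult_less_top)
  finally show ?thesis .
qed

lemma unit_volume_powr_mean_pos:
  assumes "AE \<omega> in M. 0 < unit_volume \<omega>" "0 \<le> a"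
  shows "0 < (\<integral>\<omega>. unit_volume \<omega> powr a \<partial>M)"
proof -
  have int: "integrable M (\<lambda>\<omega>. unit_volume \<omega> powr a)"
  proof (rule integrable_const_bound)
    show "AE \<omega> in M. norm (unit_volume \<omega> powr a) \<le> V powr a"
      using unit_volume_le by eventually_elim (use assms(2) in \<open>simp add: powr_mono2\<close>)
  qed measurable
  have "(\<integral>\<omega>. unit_volume \<omega> powr a \<partial>M) \<noteq> 0"
  proof
    assume "(\<integral>\<omega>. unit_volume \<omega> powr a \<partial>M) = 0"
    then have "AE \<omega> in M. unit_volume \<omega> powr a = 0"
      using integral_nonneg_eq_0_iff_AE[OF int] by simp
    with assms(1) have "AE \<omega> in M. False" by eventually_elim simp
    then show False by simp
  qed
  moreover have "0 \<le> (\<integral>\<omega>. unit_volume \<omega> powr a \<partial>M)" by simp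
  ultimately show ?thesis by linarith
qed

end

section \<open>Power tails\<close>

locale power_tail_grain = homothetic_grain_setup M R \<Xi>0 V \<delta>
  for M :: "'w measure" and R :: "'w \<Rightarrow> real" and \<Xi>0 :: "'w \<Rightarrow> 'a::euclidean_space set" and V \<delta> :: real +
  fixes \<alpha> c :: real
  assumes alpha: "1 < \<alpha>"
    and tail: "((\<lambda>x. x powr \<alpha> * measure M {\<omega> \<in> space M. x < R \<omega>}) \<longlongrightarrow> c) at_top"
begin

lemma tail_bound: "\<exists>K>0. \<forall>x>0. x powr \<alpha> * prob {\<omega> \<in> space M. x < R \<omega>} \<le> K"
  by (rule tail_bound_of_limit[OF tail]) (use alpha in auto)

lemma truncated_mean_le:
  "\<exists>C\<ge>0. \<forall>y>0. (\<integral>\<^sup>+\<omega>. ennreal (R \<omega>) * indicator {y<..} (R \<omega>) \<partial>M) \<le> ennreal (C * y powr (1 - \<alpha>))"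
proof -
  obtain K where K: "0 < K" "\<And>x. 0 < x \<Longrightarrow> x powr \<alpha> * prob {\<omega> \<in> space M. x < R \<omega>} \<le> K"
    using tail_bound by blast
  show ?thesis
    using truncated_mean_bound[OF prob_space_axioms R_measurable alpha K] K(1) alpha
    by (intro exI[of _ "K * (1 + 1 / (\<alpha> - 1))"]) auto
qed

lemma R_mean_finite: "(\<integral>\<^sup>+\<omega>. ennreal (R \<omega>) \<partial>M) < \<infinity>"
proof -
  obtain C where C: "\<And>y. 0 < y \<Longrightarrow> (\<integral>\<^sup>+\<omega>. ennreal (R \<omega>) * indicator {y<..} (R \<omega>) \<partial>M) \<le> ennreal (C * y powr (1 - \<alpha>))"
    using truncated_mean_le by blast
  have "(\<integral>\<^sup>+\<omega>. ennreal (R \<omega>) \<partial>M) \<le> ennreal 1 + ennreal (C * 1 powr (1 - \<alpha>))"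
    by (rule order_trans[OF R_mean_le_truncated add_left_mono[OF C]]) auto
  also have "\<dots> < \<infinity>" by simp
  finally show ?thesis .
qed

lemma mean_overlap_grain_le:
  "\<exists>C\<ge>0. \<forall>t. t \<noteq> 0 \<longrightarrow> mean_overlap M \<Xi> t \<le> C * ((norm t / 4) ^ DIM('a)) powr (1 - \<alpha>)"
proof -
  obtain C where C: "0 \<le> C"
      "\<And>y. 0 < y \<Longrightarrow> (\<integral>\<^sup>+\<omega>. ennreal (R \<omega>) * indicator {y<..} (R \<omega>) \<partial>M) \<le> ennreal (C * y powr (1 - \<alpha>))"
    using truncated_mean_le by blast
  have "mean_overlap M \<Xi> t \<le> V * C * ((norm t / 4) ^ DIM('a)) powr (1 - \<alpha>)" if "t \<noteq> 0" for t
  proof -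
    have "ennreal (mean_overlap M \<Xi> t) \<le> ennreal V * ennreal (C * ((norm t / 4) ^ DIM('a)) powr (1 - \<alpha>))"
      by (rule order_trans[OF mean_overlap_le_truncated[OF R_mean_finite]])
        (intro mult_left_mono C(2), use that in auto)
    then show ?thesis
      using C(1) by (simp add: ennreal_mult[symmetric] mult.assoc)
  qed
  then show ?thesis using C(1) by (intro exI[of _ "V * C"]) auto
qed

lemma mean_volume_outside_le:
  "\<exists>C\<ge>0. \<forall>l>0. (\<integral>\<omega>. measure lborel (\<Xi> \<omega> \<inter> {t. l < norm t}) \<partial>M) \<le> C * (l ^ DIM('a)) powr (1 - \<alpha>)"
proof -
  obtain C where C: "0 \<le> C"
      "\<And>y. 0 < y \<Longrightarrow> (\<integral>\<^sup>+\<omega>. ennreal (R \<omega>) * indicator {y<..} (R \<omega>) \<partial>M) \<le> ennreal (C * y powr (1 - \<alpha>))"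
    using truncated_mean_le by blast
  have "(\<integral>\<omega>. measure lborel (\<Xi> \<omega> \<inter> {t. l < norm t}) \<partial>M) \<le> V * C * (l ^ DIM('a)) powr (1 - \<alpha>)" if "0 < l" for l
  proof (rule integral_le_nn_integral_bound[OF _ AE_volume_outside_le])
    show "(\<integral>\<^sup>+\<omega>. ennreal V * (ennreal (R \<omega>) * indicator {l ^ DIM('a)<..} (R \<omega>)) \<partial>M)
        \<le> ennreal (V * C * (l ^ DIM('a)) powr (1 - \<alpha>))"
      using mult_left_mono[OF C(2)[of "l ^ DIM('a)"], of "ennreal V"] that C(1)
      by (simp add: nn_integral_cmult ennreal_mult[symmetric] mult.assoc)
  qed (use that C(1) in auto)
  then show ?thesis using C(1) by (intro exI[of _ "V * C"]) auto
qed

text \<open>Breiman's theorem with a bounded factor. Where \<open>unit_volume \<omega>\<close> is \<open>0\<close>, its product with any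
  value of \<open>R\<close> stays below \<open>x\<close> and \<open>unit_volume \<omega> powr \<alpha>\<close> is \<open>0\<close>, so the integrand \<open>?s\<close> has the
  right value there although \<open>x / 0 = 0\<close>.\<close>

lemma grain_volume_tail:
  "((\<lambda>x. x powr \<alpha> * prob {\<omega> \<in> space M. x < measure lborel (\<Xi> \<omega>)})
    \<longlongrightarrow> c * (\<integral>\<omega>. unit_volume \<omega> powr \<alpha> \<partial>M)) at_top"
proof -
  interpret MM: pair_sigma_finite M M ..
  let ?F = "\<lambda>x. prob {\<omega> \<in> space M. x < R \<omega>}"
  let ?h = "\<lambda>y. y powr \<alpha> * ?F y"
  let ?s = "\<lambda>x \<omega>. unit_volume \<omega> powr \<alpha> * ?h (x / unit_volume \<omega>)"
  have [measurable]: "?F \<in> borel_measurable borel"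
    unfolding measure_def by measurable
  obtain K where K: "0 < K" "\<And>x. 0 < x \<Longrightarrow> ?h x \<le> K"
    using tail_bound by blast
  have conv: "x powr \<alpha> * prob {\<omega> \<in> space M. x < measure lborel (\<Xi> \<omega>)} = (\<integral>\<omega>. ?s x \<omega> \<partial>M)" if "0 < x" for x
  proof -
    let ?\<Phi> = "\<lambda>(r, F). of_bool (x < r * enn2real (emeasure lborel F)) :: ennreal"
    have [measurable]: "(\<lambda>\<omega>. measure lborel (\<Xi> \<omega>)) \<in> borel_measurable M"
      unfolding measure_def by measurable
    have "ennreal (prob {\<omega> \<in> space M. x < measure lborel (\<Xi> \<omega>)}) = (\<integral>\<^sup>+\<omega>. indicator {\<omega> \<in> space M. x < measure lborel (\<Xi> \<omega>)} \<omega> \<partial>M)"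
      by (simp add: emeasure_eq_measure)
    also have "\<dots> = (\<integral>\<^sup>+\<omega>. ?\<Phi> (R \<omega>, \<Xi>0 \<omega>) \<partial>M)"
      using AE_measure_grain AE_space
      by (intro nn_integral_cong_AE, eventually_elim) (simp add: indicator_def measure_def)
    also have "\<dots> = (\<integral>\<^sup>+\<omega>. \<integral>\<^sup>+\<omega>'. ?\<Phi> (R \<omega>, \<Xi>0 \<omega>') \<partial>M \<partial>M)"
      by (rule indep_rvs_nn_integral[OF prob_space_axioms indep]) measurable
    also have "\<dots> = (\<integral>\<^sup>+\<omega>'. \<integral>\<^sup>+\<omega>. ?\<Phi> (R \<omega>, \<Xi>0 \<omega>') \<partial>M \<partial>M)"
      by (rule MM.Fubini') measurable
    also have "\<dots> = (\<integral>\<^sup>+\<omega>'. ennreal (prob {\<omega> \<in> space M. x < R \<omega> * unit_volume \<omega>'}) \<partial>M)"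
    proof (rule nn_integral_cong)
      fix \<omega>'
      have "(\<integral>\<^sup>+\<omega>. ?\<Phi> (R \<omega>, \<Xi>0 \<omega>') \<partial>M) = (\<integral>\<^sup>+\<omega>. indicator {\<omega> \<in> space M. x < R \<omega> * unit_volume \<omega>'} \<omega> \<partial>M)"
        by (intro nn_integral_cong) (simp add: indicator_def measure_def)
      then show "(\<integral>\<^sup>+\<omega>. ?\<Phi> (R \<omega>, \<Xi>0 \<omega>') \<partial>M) = ennreal (prob {\<omega> \<in> space M. x < R \<omega> * unit_volume \<omega>'})"
        by (simp add: emeasure_eq_measure)
    qed
    finally have "prob {\<omega> \<in> space M. x < measure lborel (\<Xi> \<omega>)}
        = enn2real (\<integral>\<^sup>+\<omega>'. ennreal (prob {\<omega> \<in> space M. x < R \<omega> * unit_volume \<omega>'}) \<partial>M)"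
      by (metis enn2real_ennreal measure_nonneg)
    also have "\<dots> = (\<integral>\<omega>'. prob {\<omega> \<in> space M. x < R \<omega> * unit_volume \<omega>'} \<partial>M)"
      by (rule integral_eq_nn_integral[symmetric]) (auto simp: measure_def)
    finally have "x powr \<alpha> * prob {\<omega> \<in> space M. x < measure lborel (\<Xi> \<omega>)}
        = (\<integral>\<omega>'. x powr \<alpha> * prob {\<omega> \<in> space M. x < R \<omega> * unit_volume \<omega>'} \<partial>M)"
      by simp
    also have "\<dots> = (\<integral>\<omega>. ?s x \<omega> \<partial>M)"
    proof (rule Bochner_Integration.integral_cong[OF refl])
      fix \<omega>'
      show "x powr \<alpha> * prob {\<omega> \<in> space M. x < R \<omega> * unit_volume \<omega>'} = ?s x \<omega>'"
      proof (cases "unit_volume \<omega>' = 0")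
        case True
        with \<open>0 < x\<close> show ?thesis by simp
      next
        case False
        then have v: "0 < unit_volume \<omega>'" using measure_nonneg[of lborel "\<Xi>0 \<omega>'"] by linarith
        with \<open>0 < x\<close> show ?thesis by (simp add: powr_divide pos_divide_less_eq)
      qed
    qed
    finally show ?thesis .
  qed
  have "((\<lambda>x. \<integral>\<omega>. ?s x \<omega> \<partial>M) \<longlongrightarrow> (\<integral>\<omega>. unit_volume \<omega> powr \<alpha> * c \<partial>M)) at_top"
  proof (rule integral_dominated_convergence_at_top[where w = "\<lambda>_. V powr \<alpha> * K"])
    show "AE \<omega> in M. ((\<lambda>x. ?s x \<omega>) \<longlongrightarrow> unit_volume \<omega> powr \<alpha> * c) at_top"
    proof (rule AE_I2)
      fix \<omega>
      show "((\<lambda>x. ?s x \<omega>) \<longlongrightarrow> unit_volume \<omega> powr \<alpha> * c) at_top"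
      proof (cases "unit_volume \<omega> = 0")
        case False
        then have v: "0 < unit_volume \<omega>" using measure_nonneg[of lborel "\<Xi>0 \<omega>"] by linarith
        have "filterlim (\<lambda>x. x / unit_volume \<omega>) at_top at_top"
          unfolding divide_inverse
          by (rule filterlim_at_top_mult_tendsto_pos[OF tendsto_const _ filterlim_ident]) (use v in simp)
        then have "((\<lambda>x. ?h (x / unit_volume \<omega>)) \<longlongrightarrow> c) at_top"
          by (rule filterlim_compose[OF tail])
        then show ?thesis by (rule tendsto_mult_left)
      qed simp
    qed
    show "\<forall>\<^sub>F x in at_top. AE \<omega> in M. norm (?s x \<omega>) \<le> V powr \<alpha> * K"
      using eventually_gt_at_top[of 0]
    proof eventually_elim
      case (elim x)
      show "AE \<omega> in M. norm (?s x \<omega>) \<le> V powr \<alpha> * K"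
        using unit_volume_le
      proof eventually_elim
        case (elim \<omega>)
        show ?case
        proof (cases "unit_volume \<omega> = 0")
          case False
          then have "0 < unit_volume \<omega>" using measure_nonneg[of lborel "\<Xi>0 \<omega>"] by linarith
          with \<open>0 < x\<close> have "0 < x / unit_volume \<omega>" by simp
          then show ?thesis
            using elim K alpha by (simp add: abs_mult mult_mono powr_mono2)
        qed (use K in simp)
      qed
    qed
  qed auto
  then have "((\<lambda>x. \<integral>\<omega>. ?s x \<omega> \<partial>M) \<longlongrightarrow> c * (\<integral>\<omega>. unit_volume \<omega> powr \<alpha> \<partial>M)) at_top"
    by (simp add: mult.commute)
  moreover have "\<forall>\<^sub>F x in at_top. (\<integral>\<omega>. ?s x \<omega> \<partial>M) = x powr \<alpha> * prob {\<omega> \<in> space M. x < measure lborel (\<Xi> \<omega>)}"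
    using eventually_gt_at_top[of 0] by eventually_elim (rule conv[symmetric])
  ultimately show ?thesis by (rule Lim_transform_eventually)
qed

lemma volume_tail_asymp_equiv:
  assumes "AE \<omega> in M. 0 < unit_volume \<omega>" "c \<noteq> 0"
  shows "(\<lambda>x. prob {\<omega> \<in> space M. x < measure lborel (\<Xi> \<omega>)}) \<sim>[at_top]
    (\<lambda>x. c * (\<integral>\<omega>. unit_volume \<omega> powr \<alpha> \<partial>M) * x powr (- \<alpha>))"
  by (subst asymp_equiv_powr_iff)
    (use unit_volume_powr_mean_pos[OF assms(1), of \<alpha>] alpha assms(2) grain_volume_tail in auto)

lemma power_dim_powr:
  assumes "0 < x"
  shows "(x ^ DIM('a)) powr (1 - \<alpha>) = x powr (- real DIM('a) * (\<alpha> - 1))"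
proof -
  have "(x ^ DIM('a)) powr (1 - \<alpha>) = x powr (real DIM('a) * (1 - \<alpha>))"
    using assms by (simp add: powr_realpow[symmetric] powr_powr)
  also have "real DIM('a) * (1 - \<alpha>) = - real DIM('a) * (\<alpha> - 1)" by (simp add: algebra_simps)
  finally show ?thesis .
qed

lemma mean_volume_outside_smallo:
  "(\<lambda>l. \<integral>\<omega>. measure lborel (\<Xi> \<omega> \<inter> {t. l < norm t}) \<partial>M) \<in> o[at_top](\<lambda>l. l powr ((1 - \<alpha>) * real DIM('a) / \<alpha>))"
proof -
  obtain C where C: "0 \<le> C"
    "\<And>l. 0 < l \<Longrightarrow> (\<integral>\<omega>. measure lborel (\<Xi> \<omega> \<inter> {t. l < norm t}) \<partial>M) \<le> C * (l ^ DIM('a)) powr (1 - \<alpha>)"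
    using mean_volume_outside_le by blast
  have "(\<lambda>l. \<integral>\<omega>. measure lborel (\<Xi> \<omega> \<inter> {t. l < norm t}) \<partial>M) \<in> O[at_top](\<lambda>l. l powr (- real DIM('a) * (\<alpha> - 1)))"
  proof (rule bigoI[where c = C])
    show "\<forall>\<^sub>F l in at_top. norm (\<integral>\<omega>. measure lborel (\<Xi> \<omega> \<inter> {t. l < norm t}) \<partial>M) \<le> C * norm (l powr (- real DIM('a) * (\<alpha> - 1)))"
      using eventually_gt_at_top[of 0]
    proof eventually_elim
      case (elim l)
      have "0 \<le> (\<integral>\<omega>. measure lborel (\<Xi> \<omega> \<inter> {t. l < norm t}) \<partial>M)"
        by (intro Bochner_Integration.integral_nonneg measure_nonneg)
      with C(2)[OF elim] show ?case
        by (simp add: power_dim_powr[OF elim])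
    qed
  qed
  moreover have "(\<lambda>l :: real. l powr (- real DIM('a) * (\<alpha> - 1))) \<in> o[at_top](\<lambda>l. l powr ((1 - \<alpha>) * real DIM('a) / \<alpha>))"
  proof (subst powr_smallo_iff)
    have "(\<alpha> - 1) * real DIM('a) / \<alpha> < (\<alpha> - 1) * real DIM('a) / 1"
      using alpha by (intro divide_strict_left_mono) auto
    then show "- real DIM('a) * (\<alpha> - 1) < (1 - \<alpha>) * real DIM('a) / \<alpha>"
      using alpha by (simp add: field_simps)
  qed (auto simp: filterlim_ident)
  ultimately show ?thesis by (rule landau_o.big_small_trans)
qed

lemma mean_overlap_grain_bigo:
  "mean_overlap M \<Xi> \<in> O[at_infinity](\<lambda>t. norm t powr (- real DIM('a) * (\<alpha> - 1)))"
proof -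
  obtain C where C: "0 \<le> C"
    "\<And>t. t \<noteq> 0 \<Longrightarrow> mean_overlap M \<Xi> t \<le> C * ((norm t / 4) ^ DIM('a)) powr (1 - \<alpha>)"
    using mean_overlap_grain_le by blast
  show ?thesis
  proof (rule bigoI[where c = "C * 4 powr (real DIM('a) * (\<alpha> - 1))"])
    have "\<forall>\<^sub>F t in at_infinity. (t :: 'a) \<noteq> 0"
      unfolding eventually_at_infinity by (intro exI[of _ 1]) auto
    then show "\<forall>\<^sub>F t in at_infinity. norm (mean_overlap M \<Xi> t)
        \<le> C * 4 powr (real DIM('a) * (\<alpha> - 1)) * norm (norm t powr (- real DIM('a) * (\<alpha> - 1)))"
    proof eventually_elim
      case (elim t)
      have "((norm t / 4) ^ DIM('a)) powr (1 - \<alpha>) = (norm t / 4) powr (- real DIM('a) * (\<alpha> - 1))"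
        using elim by (intro power_dim_powr) simp
      also have "\<dots> = 4 powr (real DIM('a) * (\<alpha> - 1)) * norm t powr (- real DIM('a) * (\<alpha> - 1))"
        by (simp add: powr_divide powr_minus_divide)
      finally show ?case
        using C(2)[OF elim] ennreal_mean_overlap_grain(2)[OF R_mean_finite, of t] by (simp add: mult.assoc)
    qed
  qed
qed

end

section \<open>Regularly varying densities\<close>

locale power_density_grain = homothetic_grain_setup M R \<Xi>0 V \<delta>
  for M :: "'w measure" and R :: "'w \<Rightarrow> real" and \<Xi>0 :: "'w \<Rightarrow> 'a::euclidean_space set" and V \<delta> :: real +
  fixes \<alpha> c :: real and f :: "real \<Rightarrow> real"
  assumes alpha: "1 < \<alpha>"
    and f_nonneg: "\<And>r. 0 \<le> f r"
    and density: "distributed M lborel R (\<lambda>r. ennreal (f r))"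
    and tail: "((\<lambda>r. r powr (1 + \<alpha>) * f r) \<longlongrightarrow> c) at_top"
begin

lemma f_measurable [measurable]: "f \<in> borel_measurable borel"
proof -
  have "(\<lambda>r. ennreal (f r)) \<in> borel_measurable lborel"
    using density by (rule distributed_borel_measurable)
  then have "(\<lambda>r. enn2real (ennreal (f r))) \<in> borel_measurable borel" by simp
  then show ?thesis using f_nonneg by simp
qed

text \<open>The relative form of the assumption on \<open>f\<close>, with one factor \<open>r\<close> from the volume of the grain.\<close>

lemma density_near_power:
  assumes "0 < \<epsilon>"
  shows "\<exists>r0>0. \<forall>r\<ge>r0. \<bar>r * f r - c * r powr (- \<alpha>)\<bar> \<le> \<epsilon> * r powr (- \<alpha>)"
proof -
  have "\<forall>\<^sub>F r in at_top. \<bar>r powr (1 + \<alpha>) * f r - c\<bar> < \<epsilon>"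
    using tendstoD[OF tail assms] by (simp add: dist_real_def)
  then obtain r1 where r1: "\<And>r. r1 \<le> r \<Longrightarrow> \<bar>r powr (1 + \<alpha>) * f r - c\<bar> < \<epsilon>"
    by (auto simp: eventually_at_top_linorder)
  show ?thesis
  proof (intro exI[of _ "max 1 r1"] conjI allI impI)
    fix r assume r: "max 1 r1 \<le> r"
    then have "r * f r = r powr (- \<alpha>) * (r powr (1 + \<alpha>) * f r)"
      by (simp add: mult.assoc[symmetric] powr_add[symmetric])
    then have "r * f r - c * r powr (- \<alpha>) = r powr (- \<alpha>) * (r powr (1 + \<alpha>) * f r - c)"
      by (simp only: right_diff_distrib mult.commute[of c])
    then have "\<bar>r * f r - c * r powr (- \<alpha>)\<bar> = r powr (- \<alpha>) * \<bar>r powr (1 + \<alpha>) * f r - c\<bar>"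
      by (simp add: abs_mult)
    also have "\<dots> \<le> r powr (- \<alpha>) * \<epsilon>"
      using r1[of r] r by (intro mult_left_mono) auto
    finally show "\<bar>r * f r - c * r powr (- \<alpha>)\<bar> \<le> \<epsilon> * r powr (- \<alpha>)"
      by (simp add: mult.commute)
  qed simp
qed

lemma R_mean_finite: "(\<integral>\<^sup>+\<omega>. ennreal (R \<omega>) \<partial>M) < \<infinity>"
proof -
  obtain r0 where r0: "0 < r0" "\<And>r. r0 \<le> r \<Longrightarrow> \<bar>r * f r - c * r powr (- \<alpha>)\<bar> \<le> 1 * r powr (- \<alpha>)"
    using density_near_power[of 1] by auto
  have "(\<integral>\<^sup>+\<omega>. ennreal (R \<omega>) * indicator {r0<..} (R \<omega>) \<partial>M)
      = (\<integral>\<^sup>+r. ennreal (f r) * (ennreal r * indicator {r0<..} r) \<partial>lborel)"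
    by (rule distributed_nn_integral[OF density, symmetric]) simp
  also have "\<dots> \<le> (\<integral>\<^sup>+r. ennreal (\<bar>c\<bar> + 1) * (ennreal (r powr (- \<alpha>)) * indicator {r0..} r) \<partial>lborel)"
  proof (rule nn_integral_mono)
    fix r
    show "ennreal (f r) * (ennreal r * indicator {r0<..} r) \<le> ennreal (\<bar>c\<bar> + 1) * (ennreal (r powr (- \<alpha>)) * indicator {r0..} r)"
    proof (cases "r0 < r")
      case True
      have "c * r powr (- \<alpha>) \<le> \<bar>c\<bar> * r powr (- \<alpha>)" by (intro mult_right_mono) auto
      then have "f r * r \<le> (\<bar>c\<bar> + 1) * r powr (- \<alpha>)"
        using r0(2)[of r] True by (simp add: distrib_right mult.commute[of r])
      then have "ennreal (f r * r) \<le> ennreal ((\<bar>c\<bar> + 1) * r powr (- \<alpha>))"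
        by (rule ennreal_leI)
      then show ?thesis
        using True r0(1) f_nonneg[of r] by (simp add: ennreal_mult del: ennreal_plus)
    qed simp
  qed
  also have "\<dots> < \<infinity>"
    using r0(1) alpha by (simp add: nn_integral_cmult nn_integral_powr_tail ennreal_mult_less_top)
  finally have "ennreal r0 + (\<integral>\<^sup>+\<omega>. ennreal (R \<omega>) * indicator {r0<..} (R \<omega>) \<partial>M) < \<infinity>"
    by simp
  with R_mean_le_truncated[of r0] r0(1) show ?thesis by (simp add: order.strict_trans1)
qed

lemma mean_overlap_density:
  "mean_overlap M \<Xi> t = (\<integral>r. indicator {0<..} r * (mean_overlap M \<Xi>0 (t /\<^sub>R radius r) * (r * f r)) \<partial>lborel)"
  "integrable lborel (\<lambda>r. indicator {0<..} r * (mean_overlap M \<Xi>0 (t /\<^sub>R radius r) * (r * f r)))"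
proof -
  let ?g = "\<lambda>r. indicator {0<..} r * (mean_overlap M \<Xi>0 (t /\<^sub>R radius r) * (r * f r))"
  have nonneg: "0 \<le> ?g r" for r
    using unit_overlap(3) f_nonneg by (simp add: indicator_def)
  have "ennreal (mean_overlap M \<Xi> t)
      = (\<integral>\<^sup>+r. ennreal (f r) * (ennreal r * ennreal (mean_overlap M \<Xi>0 (t /\<^sub>R radius r))) \<partial>lborel)"
    unfolding ennreal_mean_overlap_grain(1)[OF R_mean_finite]
    by (rule distributed_nn_integral[OF density, symmetric]) simp
  also have "\<dots> = (\<integral>\<^sup>+r. ennreal (?g r) \<partial>lborel)"
  proof (rule nn_integral_cong)
    fix r
    show "ennreal (f r) * (ennreal r * ennreal (mean_overlap M \<Xi>0 (t /\<^sub>R radius r))) = ennreal (?g r)"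
      using f_nonneg[of r] unit_overlap(3)
      by (cases "0 < r") (simp_all add: ennreal_mult[symmetric] ennreal_neg mult_ac)
  qed
  finally have eq: "ennreal (mean_overlap M \<Xi> t) = (\<integral>\<^sup>+r. ennreal (?g r) \<partial>lborel)" .
  show "integrable lborel ?g"
    using nonneg eq by (intro integrableI_nonneg) (auto simp: less_top[symmetric] simp flip: eq)
  have "(\<integral>r. ?g r \<partial>lborel) = enn2real (\<integral>\<^sup>+r. ennreal (?g r) \<partial>lborel)"
    using nonneg by (intro integral_eq_nn_integral) auto
  then show "mean_overlap M \<Xi> t = (\<integral>r. ?g r \<partial>lborel)"
    using ennreal_mean_overlap_grain(2)[OF R_mean_finite] by (simp flip: eq)
qed

text \<open>Substituting \<open>r / norm t ^ DIM('a)\<close> for \<open>r\<close> moves the length of \<open>t\<close> from the prefactor into the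
  overlap, and so expresses the main term through the same function as \<open>mean_overlap_density\<close>.\<close>

lemma angular_function_rescaled:
  assumes "t \<noteq> 0"
  shows "angular_function M \<Xi>0 c \<alpha> (t /\<^sub>R norm t)
    = norm t powr (real DIM('a) * (\<alpha> - 1))
      * (c * (\<integral>r. indicator {0<..} r * (mean_overlap M \<Xi>0 (t /\<^sub>R radius r) * r powr (- \<alpha>)) \<partial>lborel))"
proof -
  define T where "T = norm t powr real DIM('a)"
  have T: "0 < T" using assms by (simp add: T_def)
  let ?f = "\<lambda>r. indicator {0<..} r * (mean_overlap M \<Xi>0 (r powr (- 1 / real DIM('a)) *\<^sub>R (t /\<^sub>R norm t)) * r powr (- \<alpha>))"
  let ?g = "\<lambda>r. indicator {0<..} r * (mean_overlap M \<Xi>0 (t /\<^sub>R radius r) * r powr (- \<alpha>))"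
  have "(\<integral>r. ?f r \<partial>lborel) = \<bar>1 / T\<bar> *\<^sub>R (\<integral>r. ?f (0 + 1 / T * r) \<partial>lborel)"
    by (rule lborel_integral_real_affine) (use T in simp)
  also have "(\<lambda>r. ?f (0 + 1 / T * r)) = (\<lambda>r. T powr \<alpha> * ?g r)"
  proof
    fix r
    show "?f (0 + 1 / T * r) = T powr \<alpha> * ?g r"
    proof (cases "0 < r")
      case True
      have "(r / T) powr (- 1 / real DIM('a)) = norm t / radius r"
        using True assms by (simp add: T_def powr_divide powr_powr delta_def powr_minus field_simps)
      then have "(r / T) powr (- 1 / real DIM('a)) *\<^sub>R (t /\<^sub>R norm t) = (norm t / radius r) *\<^sub>R (t /\<^sub>R norm t)"
        by (simp only:)
      also have "\<dots> = t /\<^sub>R radius r"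
        using assms by (simp add: divide_inverse)
      finally have arg: "(r / T) powr (- 1 / real DIM('a)) *\<^sub>R (t /\<^sub>R norm t) = t /\<^sub>R radius r" .
      have fac: "(r / T) powr (- \<alpha>) = T powr \<alpha> * r powr (- \<alpha>)"
        using True T by (simp add: powr_divide powr_minus field_simps)
      have "0 + 1 / T * r = r / T" by simp
      then show ?thesis
        unfolding arg fac by (simp only: arg fac) (use True T in \<open>simp add: mult_ac\<close>)
    next
      case False
      then have "\<not> 0 < r / T" using T by (simp add: zero_less_divide_iff)
      with False show ?thesis by simp
    qed
  qed
  also have "\<bar>1 / T\<bar> *\<^sub>R (\<integral>r. T powr \<alpha> * ?g r \<partial>lborel) = T powr (\<alpha> - 1) * (\<integral>r. ?g r \<partial>lborel)"
    using T by (simp add: powr_diff)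
  also have "T powr (\<alpha> - 1) = norm t powr (real DIM('a) * (\<alpha> - 1))"
    by (simp add: T_def powr_powr)
  finally show ?thesis
    by (simp add: angular_function_def set_lebesgue_integral_def)
qed

text \<open>The overlap confines the integral to \<open>r \<ge> (norm t / 4) ^ DIM('a)\<close>, where \<open>near\<close> holds. The integral
  of \<open>r powr (- \<alpha>)\<close> over this half-line is a constant times \<open>norm t powr (- DIM('a) * (\<alpha> - 1))\<close>, which
  cancels the normalisation; the bound thus depends on neither the length nor the direction of \<open>t\<close>.\<close>

lemma angular_error_le:
  assumes "t \<noteq> 0" "0 < \<epsilon>" "0 < r0"
    and near: "\<And>r. r0 \<le> r \<Longrightarrow> \<bar>r * f r - c * r powr (- \<alpha>)\<bar> \<le> \<epsilon> * r powr (- \<alpha>)"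
    and far: "r0 \<le> (norm t / 4) ^ DIM('a)"
  shows "\<bar>norm t powr (real DIM('a) * (\<alpha> - 1)) * mean_overlap M \<Xi> t - angular_function M \<Xi>0 c \<alpha> (t /\<^sub>R norm t)\<bar>
    \<le> V * \<epsilon> * (4 powr (real DIM('a) * (\<alpha> - 1)) / (\<alpha> - 1))"
proof -
  let ?d = "real DIM('a)"
  define y where "y = (norm t / 4) ^ DIM('a)"
  have y: "0 < y" using assms(1) by (simp add: y_def)
  let ?g = "\<lambda>r. indicator {0<..} r * mean_overlap M \<Xi>0 (t /\<^sub>R radius r)"
  have g_le: "\<bar>?g r\<bar> \<le> V * indicator {y..} r" for r
    using unit_overlap_le[of "t /\<^sub>R radius r"] unit_overlap(3)[of "t /\<^sub>R radius r"] rescaled_overlap_eq_0[of r t] y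
    by (auto simp: indicator_def y_def)
  have int_pow: "(\<integral>\<^sup>+r. ennreal (C * (r powr (- \<alpha>) * indicator {y..} r)) \<partial>lborel) = ennreal (C * (y powr (1 - \<alpha>) / (\<alpha> - 1)))"
    if "0 \<le> C" for C
  proof -
    have "(\<integral>\<^sup>+r. ennreal (C * (r powr (- \<alpha>) * indicator {y..} r)) \<partial>lborel)
        = ennreal C * (\<integral>\<^sup>+r. ennreal (r powr (- \<alpha>)) * indicator {y..} r \<partial>lborel)"
      using that by (simp add: ennreal_mult ennreal_indicator nn_integral_cmult)
    then show ?thesis
      using that alpha by (simp only: nn_integral_powr_tail[OF y alpha] ennreal_mult[symmetric]
          divide_nonneg_pos powr_ge_zero diff_gt_0_iff_gt)
  qed
  have A: "integrable lborel (\<lambda>r. ?g r * (r * f r))"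
    using mean_overlap_density(2)[of t] by (simp add: mult.assoc)
  have g_meas [measurable]: "?g \<in> borel_measurable borel" by measurable
  have B: "integrable lborel (\<lambda>r. ?g r * r powr (- \<alpha>))"
  proof (rule Bochner_Integration.integrable_bound)
    show "integrable lborel (\<lambda>r. V * (r powr (- \<alpha>) * indicator {y..} r))"
      by (rule integrableI_nonneg) (auto simp: int_pow)
    show "AE r in lborel. norm (?g r * r powr (- \<alpha>)) \<le> norm (V * (r powr (- \<alpha>) * indicator {y..} r))"
    proof (rule AE_I2)
      fix r
      have "\<bar>?g r\<bar> * r powr (- \<alpha>) \<le> V * indicator {y..} r * r powr (- \<alpha>)"
        by (intro mult_right_mono g_le) auto
      then show "norm (?g r * r powr (- \<alpha>)) \<le> norm (V * (r powr (- \<alpha>) * indicator {y..} r))"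
        by (simp add: abs_mult mult_ac)
    qed
  qed measurable
  let ?I = "\<lambda>r. ?g r * (r * f r) - c * (?g r * r powr (- \<alpha>))"
  let ?J = "(\<integral>r. ?I r \<partial>lborel)"
  have J: "?J = mean_overlap M \<Xi> t - c * (\<integral>r. ?g r * r powr (- \<alpha>) \<partial>lborel)"
    using A B mean_overlap_density(1)[of t] by (simp add: mult.assoc)
  have "\<bar>?J\<bar> \<le> (\<integral>r. \<bar>?I r\<bar> \<partial>lborel)"
    by (rule integral_abs_bound)
  also have "\<dots> \<le> V * \<epsilon> * (y powr (1 - \<alpha>) / (\<alpha> - 1))"
  proof (rule integral_le_nn_integral_bound[where b = "\<lambda>r. ennreal (V * \<epsilon> * (r powr (- \<alpha>) * indicator {y..} r))"])
    show "AE r in lborel. ennreal \<bar>?I r\<bar> \<le> ennreal (V * \<epsilon> * (r powr (- \<alpha>) * indicator {y..} r))"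
    proof (intro AE_I2 ennreal_leI)
      fix r
      have "\<bar>?I r\<bar> = \<bar>?g r\<bar> * \<bar>r * f r - c * r powr (- \<alpha>)\<bar>"
        unfolding abs_mult[symmetric] by (rule arg_cong[where f = abs]) (simp add: algebra_simps)
      also have "\<dots> \<le> V * indicator {y..} r * \<bar>r * f r - c * r powr (- \<alpha>)\<bar>"
        by (intro mult_right_mono g_le) auto
      also have "\<dots> \<le> V * indicator {y..} r * (\<epsilon> * r powr (- \<alpha>))"
        using near[of r] far by (cases "y \<le> r") (auto simp: y_def intro!: mult_left_mono)
      finally show "\<bar>?I r\<bar> \<le> V * \<epsilon> * (r powr (- \<alpha>) * indicator {y..} r)"
        by (simp add: mult_ac)
    qed
  qed (use int_pow[of "V * \<epsilon>"] assms alpha in auto)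
  finally have J_le: "\<bar>?J\<bar> \<le> V * \<epsilon> * (y powr (1 - \<alpha>) / (\<alpha> - 1))" .
  have "norm t powr (?d * (\<alpha> - 1)) * mean_overlap M \<Xi> t - angular_function M \<Xi>0 c \<alpha> (t /\<^sub>R norm t)
      = norm t powr (?d * (\<alpha> - 1)) * ?J"
    unfolding J angular_function_rescaled[OF assms(1)] by (simp add: right_diff_distrib mult.assoc)
  also have "\<bar>\<dots>\<bar> \<le> norm t powr (?d * (\<alpha> - 1)) * (V * \<epsilon> * (y powr (1 - \<alpha>) / (\<alpha> - 1)))"
    using mult_left_mono[OF J_le, of "norm t powr (?d * (\<alpha> - 1))"] by (simp add: abs_mult)
  also have "\<dots> = V * \<epsilon> * (4 powr (?d * (\<alpha> - 1)) / (\<alpha> - 1))"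
  proof -
    have "y powr (1 - \<alpha>) = (norm t / 4) powr (?d * (1 - \<alpha>))"
      using assms(1) by (simp add: y_def powr_realpow[symmetric] powr_powr)
    also have "\<dots> = 4 powr (?d * (\<alpha> - 1)) / norm t powr (?d * (\<alpha> - 1))"
      using assms(1) powr_minus[of "norm t / 4" "?d * (\<alpha> - 1)"]
      by (simp add: powr_divide minus_mult_right[symmetric] field_simps flip: minus_mult_right)
    finally show ?thesis using assms(1) by simp
  qed
  finally show ?thesis .
qed

lemma angular_error_tendsto_0:
  "((\<lambda>t. norm t powr (real DIM('a) * (\<alpha> - 1)) * mean_overlap M \<Xi> t - angular_function M \<Xi>0 c \<alpha> (t /\<^sub>R norm t))
    \<longlongrightarrow> 0) at_infinity"
proof (rule tendstoI)
  fix \<eta> :: real assume "0 < \<eta>"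
  define C where "C = V * (4 powr (real DIM('a) * (\<alpha> - 1)) / (\<alpha> - 1))"
  have C: "0 \<le> C" using alpha by (simp add: C_def)
  define \<epsilon> where "\<epsilon> = \<eta> / (C + 1)"
  have eps: "0 < \<epsilon>" "C * \<epsilon> < \<eta>"
    using C \<open>0 < \<eta>\<close> by (auto simp: \<epsilon>_def field_simps)
  obtain r0 where r0: "0 < r0" "\<And>r. r0 \<le> r \<Longrightarrow> \<bar>r * f r - c * r powr (- \<alpha>)\<bar> \<le> \<epsilon> * r powr (- \<alpha>)"
    using density_near_power[OF eps(1)] by blast
  show "\<forall>\<^sub>F t in at_infinity. dist (norm t powr (real DIM('a) * (\<alpha> - 1)) * mean_overlap M \<Xi> t
      - angular_function M \<Xi>0 c \<alpha> (t /\<^sub>R norm t)) 0 < \<eta>"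
    unfolding eventually_at_infinity
  proof (intro exI[of _ "4 * max 1 r0"] allI impI)
    fix t :: 'a assume t: "4 * max 1 r0 \<le> norm t"
    then have "1 \<le> norm t / 4" by simp
    then have "norm t / 4 \<le> (norm t / 4) ^ DIM('a)"
      using power_increasing[of 1 "DIM('a)" "norm t / 4"] DIM_positive[where 'a='a] by (simp add: Suc_le_eq)
    with t have "r0 \<le> (norm t / 4) ^ DIM('a)" by simp
    moreover have "t \<noteq> 0" using t by auto
    ultimately have "\<bar>norm t powr (real DIM('a) * (\<alpha> - 1)) * mean_overlap M \<Xi> t
        - angular_function M \<Xi>0 c \<alpha> (t /\<^sub>R norm t)\<bar> \<le> C * \<epsilon>"
      using angular_error_le[OF _ eps(1) r0(1) r0(2)] by (simp add: C_def mult_ac)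
    with eps(2) show "dist (norm t powr (real DIM('a) * (\<alpha> - 1)) * mean_overlap M \<Xi> t
        - angular_function M \<Xi>0 c \<alpha> (t /\<^sub>R norm t)) 0 < \<eta>"
      by (simp add: dist_real_def)
  qed
qed

end

section \<open>Volume tail and covariance of the homothetic grain\<close>

theorem proposition1:
  fixes M :: "'w measure" and R :: "'w \<Rightarrow> real" and \<Xi>0 \<Xi> :: "'w \<Rightarrow> (real ^ 'n) set"
    and N :: "'v measure" and u :: "nat \<Rightarrow> 'v \<Rightarrow> real ^ 'n" and G :: "nat \<Rightarrow> 'v \<Rightarrow> (real ^ 'n) set"
    and \<nu> :: real
  assumes nu: "\<nu> = real CARD('n)"
    and R: "R \<in> borel_measurable M" "AE \<omega> in M. 0 < R \<omega>"
    and Xi0: "random_closed_set M \<Xi>0"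
      "AE \<omega> in M. \<Xi>0 \<omega> \<subseteq> {t. norm t \<le> 1}"
      "AE \<omega> in M. 0 < measure lborel (\<Xi>0 \<omega>)"
    and indep: "indep_rvs M borel R fell_borel \<Xi>0"
    and Xi: "\<Xi> = homothetic_grain R \<Xi>0"
  shows
    "(random_grain_model M \<Xi> N u G \<longrightarrow>
        (\<forall>t. covar N (grain_field u G 0) (grain_field u G t) = mean_overlap M \<Xi> t)) \<and>
     (\<comment> \<open>(i)\<close>
      \<forall>\<alpha> c\<^sub>R. 1 < \<alpha> \<and> \<alpha> < 2 \<and> 0 < c\<^sub>R \<and>
        (\<lambda>x. measure M {\<omega> \<in> space M. x < R \<omega>}) \<sim>[at_top] (\<lambda>x. c\<^sub>R * x powr (- \<alpha>)) \<longrightarrow>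
        (\<integral>\<^sup>+\<omega>. emeasure lborel (\<Xi> \<omega>) \<partial>M) < \<infinity> \<and>
        (\<lambda>x. measure M {\<omega> \<in> space M. x < measure lborel (\<Xi> \<omega>)}) \<sim>[at_top]
          (\<lambda>x. (c\<^sub>R * (\<integral>\<omega>. measure lborel (\<Xi>0 \<omega>) powr \<alpha> \<partial>M)) * x powr (- \<alpha>)) \<and>
        (\<lambda>l. \<integral>\<omega>. measure lborel (\<Xi> \<omega> \<inter> {t. l < norm t}) \<partial>M)
          \<in> o[at_top](\<lambda>l. l powr ((1 - \<alpha>) * \<nu> / \<alpha>)) \<and>
        mean_overlap M \<Xi> \<in> O[at_infinity](\<lambda>t. norm t powr (- \<nu> * (\<alpha> - 1))) \<and>
        (random_grain_model M \<Xi> N u G \<longrightarrow>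
          (\<lambda>t. covar N (grain_field u G 0) (grain_field u G t))
            \<in> O[at_infinity](\<lambda>t. norm t powr (- \<nu> * (\<alpha> - 1))))) \<and>
     (\<comment> \<open>(ii)\<close>
      \<forall>\<alpha> c\<^sub>f f. 1 < \<alpha> \<and> \<alpha> < 2 \<and> 0 < c\<^sub>f \<and> (\<forall>r. 0 \<le> f r) \<and>
        distributed M lborel R (\<lambda>r. ennreal (f r)) \<and>
        f \<sim>[at_top] (\<lambda>r. c\<^sub>f * r powr (- 1 - \<alpha>)) \<and>
        continuous_on (- {0}) (mean_overlap M \<Xi>0) \<longrightarrow>
        (\<integral>\<^sup>+\<omega>. emeasure lborel (\<Xi> \<omega>) \<partial>M) < \<infinity> \<and>
        (\<exists>e. (e \<longlongrightarrow> 0) at_infinity \<and>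
          (\<forall>t. t \<noteq> 0 \<longrightarrow>
            mean_overlap M \<Xi> t = norm t powr (- \<nu> * (\<alpha> - 1)) *
              (angular_function M \<Xi>0 c\<^sub>f \<alpha> (t /\<^sub>R norm t) + e t) \<and>
            (random_grain_model M \<Xi> N u G \<longrightarrow>
              covar N (grain_field u G 0) (grain_field u G t) = norm t powr (- \<nu> * (\<alpha> - 1)) *
                (angular_function M \<Xi>0 c\<^sub>f \<alpha> (t /\<^sub>R norm t) + e t))))) \<and>
     (\<comment> \<open>(iii)\<close>
      (\<integral>\<^sup>+\<omega>. ennreal ((R \<omega>)\<^sup>2) \<partial>M) < \<infinity> \<longrightarrow>
        (\<integral>\<^sup>+\<omega>. (emeasure lborel (\<Xi> \<omega>))\<^sup>2 \<partial>M) < \<infinity>)"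
proof -
  define V where "V = measure lborel (cball 0 1 :: (real ^ 'n) set)"
  define \<delta> where "\<delta> = 1 / real DIM(real ^ 'n)"
  interpret homothetic_grain_setup M R \<Xi>0 V \<delta>
    by unfold_locales (use R Xi0 indep in \<open>auto simp: V_def \<delta>_def\<close>)
  have dim: "real DIM(real ^ 'n) = \<nu>" by (simp add: nu)
  note covariance = random_grain_model_covariance[of M \<Xi> N u G]
  have i: "(\<integral>\<^sup>+\<omega>. emeasure lborel (\<Xi> \<omega>) \<partial>M) < \<infinity> \<and>
        (\<lambda>x. measure M {\<omega> \<in> space M. x < measure lborel (\<Xi> \<omega>)}) \<sim>[at_top]
          (\<lambda>x. (c * (\<integral>\<omega>. measure lborel (\<Xi>0 \<omega>) powr \<alpha> \<partial>M)) * x powr (- \<alpha>)) \<and>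
        (\<lambda>l. \<integral>\<omega>. measure lborel (\<Xi> \<omega> \<inter> {t. l < norm t}) \<partial>M)
          \<in> o[at_top](\<lambda>l. l powr ((1 - \<alpha>) * \<nu> / \<alpha>)) \<and>
        mean_overlap M \<Xi> \<in> O[at_infinity](\<lambda>t. norm t powr (- \<nu> * (\<alpha> - 1)))"
    if "1 < \<alpha>" "0 < c"
      and tail: "(\<lambda>x. measure M {\<omega> \<in> space M. x < R \<omega>}) \<sim>[at_top] (\<lambda>x. c * x powr (- \<alpha>))" for \<alpha> c
  proof -
    interpret power_tail_grain M R \<Xi>0 V \<delta> \<alpha> c
      by unfold_locales (use that asymp_equiv_powr_iff[of c _ \<alpha>] in auto)
    show ?thesis
      using grain_mean_finite[OF R_mean_finite] volume_tail_asymp_equiv[OF Xi0(3)] \<open>0 < c\<close>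
        mean_volume_outside_smallo mean_overlap_grain_bigo
      unfolding Xi dim by simp
  qed
  have ii: "(\<integral>\<^sup>+\<omega>. emeasure lborel (\<Xi> \<omega>) \<partial>M) < \<infinity> \<and>
        (\<exists>e. (e \<longlongrightarrow> 0) at_infinity \<and>
          (\<forall>t. t \<noteq> 0 \<longrightarrow> mean_overlap M \<Xi> t = norm t powr (- \<nu> * (\<alpha> - 1)) *
              (angular_function M \<Xi>0 c \<alpha> (t /\<^sub>R norm t) + e t)))"
    if "1 < \<alpha>" "0 < c" "\<forall>r. 0 \<le> f r" "distributed M lborel R (\<lambda>r. ennreal (f r))"
      and tail: "f \<sim>[at_top] (\<lambda>r. c * r powr (- 1 - \<alpha>))" for \<alpha> c f
  proof -
    have "f \<sim>[at_top] (\<lambda>r. c * r powr (- (1 + \<alpha>)))" using tail by (simp add: algebra_simps)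
    then interpret power_density_grain M R \<Xi>0 V \<delta> \<alpha> c f
      by unfold_locales (use that asymp_equiv_powr_iff[of c f "1 + \<alpha>"] in auto)
    let ?e = "\<lambda>t. norm t powr (\<nu> * (\<alpha> - 1)) * mean_overlap M \<Xi> t - angular_function M \<Xi>0 c \<alpha> (t /\<^sub>R norm t)"
    have "(?e \<longlongrightarrow> 0) at_infinity"
      using angular_error_tendsto_0 unfolding Xi dim .
    moreover have "mean_overlap M \<Xi> t = norm t powr (- \<nu> * (\<alpha> - 1)) * (angular_function M \<Xi>0 c \<alpha> (t /\<^sub>R norm t) + ?e t)"
      if "t \<noteq> 0" for t
    proof -
      have "norm t powr (- \<nu> * (\<alpha> - 1)) * norm t powr (\<nu> * (\<alpha> - 1)) = 1"
        using that by (simp add: powr_add[symmetric])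
      then show ?thesis by (simp add: mult.assoc[symmetric])
    qed
    ultimately show ?thesis
      using grain_mean_finite[OF R_mean_finite] unfolding Xi by blast
  qed
  have covar_eq: "(\<lambda>t. covar N (grain_field u G 0) (grain_field u G t)) = mean_overlap M \<Xi>"
    if "random_grain_model M \<Xi> N u G"
    using covariance[OF that] by auto
  show ?thesis
  proof (intro conjI allI impI; (elim conjE)?)
    show "covar N (grain_field u G 0) (grain_field u G t) = mean_overlap M \<Xi> t"
      if "random_grain_model M \<Xi> N u G" for t
      by (rule covariance[OF that])
  next
    show "(\<integral>\<^sup>+\<omega>. (emeasure lborel (\<Xi> \<omega>))\<^sup>2 \<partial>M) < \<infinity>" if "(\<integral>\<^sup>+\<omega>. ennreal ((R \<omega>)\<^sup>2) \<partial>M) < \<infinity>"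
      unfolding Xi by (rule grain_second_moment_finite[OF that])
  next
    fix \<alpha> c f
    assume "1 < \<alpha>" "0 < c" "\<forall>r. 0 \<le> f r" "distributed M lborel R (\<lambda>r. ennreal (f r))"
      "f \<sim>[at_top] (\<lambda>r. c * r powr (- 1 - \<alpha>))"
    from ii[OF this] show "\<exists>e. (e \<longlongrightarrow> 0) at_infinity \<and>
          (\<forall>t. t \<noteq> 0 \<longrightarrow>
            mean_overlap M \<Xi> t = norm t powr (- \<nu> * (\<alpha> - 1)) *
              (angular_function M \<Xi>0 c \<alpha> (t /\<^sub>R norm t) + e t) \<and>
            (random_grain_model M \<Xi> N u G \<longrightarrow>
              covar N (grain_field u G 0) (grain_field u G t) = norm t powr (- \<nu> * (\<alpha> - 1)) *
                (angular_function M \<Xi>0 c \<alpha> (t /\<^sub>R norm t) + e t)))"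
      using covariance by metis
  qed (use i ii covar_eq in \<open>auto simp del: infinity_ennreal_def\<close>)
qed

end
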